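(* Let $f:\mathbb{R}^d\to\mathbb{R}$, $f(x)=\mathbb{E}_\xi[\ell(x;\xi)]$, be convex and $G$-Lipschitz continuous (not necessarily differentiable), let $h:\mathbb{R}^d\to\mathbb{R}\cup\{+\infty\}$ be convex, proper and lower semicontinuous, and suppose $F=f+h$ attains its minimum $F^*=F(x^* )$ at some $x^*\in\mathbb{R}^d$. Let $\gamma,\eta>0$ be arbitrary, and let $\{x_k\}_{k\ge1}$ be the iterates generated by the stochastic adaptive proximal gradient method with unit batch size described in the context, started at $x_1\in\mathrm{dom}(h)$. Suppose that the bounded-iterates assumption with constant $D>0$ and the unbiasedness and bounded-variance assumption with constant $\sigma>0$ stated in the context hold. Let $\bar x_t:=\frac1t\sum_{k=1}^tx_{k+1}$. Then there is a constant $c>0$ depending only on the fixed quantities $G,\gamma,\eta,D$ and $F(x_1)-F^*$ such that for any $t\ge1$, $$\mathbb{E}[F(\bar x_t)-F^*]\le c\,\frac{(1+\sigma)\sqrt{\log\big((1+\sigma^2)t\big)}}{\sqrt t}.$$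
   Context: $\|\cdot\|$ is the Euclidean norm and $\log$ the natural logarithm. $f$ is $G$-Lipschitz continuous if $|f(y)-f(x)|\le G\|y-x\|$ for all $x,y$. $\nabla f(x)$ denotes a subgradient of $f$ at $x$ when $f$ is not differentiable, and $\partial f(x)$ is the set of all subgradients of $f$ at $x$. $\mathrm{dom}(h):=\{x:h(x)<+\infty\}$. Stochastic adaptive proximal gradient method with unit batch size: set $S_1:=\gamma$. For $k=1,2,\dots$: draw a sample $\xi_k$ (independent of the past) from the data distribution; set $g_k:=\nabla\ell(x_k;\xi_k)$; $$x_{k+1}:=\operatorname*{arg\,min}_{x\in\mathbb{R}^d}\Big\{\langle g_k,x\rangle+\frac{S_k}{2\eta}\|x-x_k\|^2+h(x)\Big\},\qquad S_{k+1}^2:=S_k^2\Big(1+\frac{\|x_{k+1}-x_k\|^2}{\eta^2}\Big),\ S_{k+1}>0.$$ Let $\mathbb{E}_k[\cdot]$ denote conditional expectation given all samples $\xi_1,\dots,\xi_{k-1}$ used before iteration $k$. Bounded-iterates assumption: $\|x_{k+1}-x_k\|\le D$ and $\|x_k-x^*\|\le D$ for all $k\ge1$. Unbiasedness and bounded variance: for all $k\ge1$, $\mathbb{E}_k[g_k]=\nabla f(x_k)\in\partial f(x_k)$ and $\mathbb{E}_k[\|g_k-\nabla f(x_k)\|^2]\le\sigma^2$.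
   Formalization: The argument of the logarithm is max{2,(1+σ²)t} instead of (1+σ²)t; this differs only for t=1 and σ<1, where the stated bound fails for every c independent of σ (noiseless case, σ→0). The constant c is given explicitly. *)

theory Defs
  imports "HOL-Probability.Probability"
begin

definition subdifferential :: "('a::real_inner \<Rightarrow> real) \<Rightarrow> 'a \<Rightarrow> 'a set" where
  "subdifferential \<phi> x = {v. \<forall>y. \<phi> x + v \<bullet> (y - x) \<le> \<phi> y}"

text \<open>The value denoted by a nabla sign: the gradient where there is one, otherwise some
  subgradient.  Convexity of \<open>\<phi>\<close> is not required.\<close>
definition grad_or_subgrad :: "('a::real_inner \<Rightarrow> real) \<Rightarrow> 'a \<Rightarrow> 'a \<Rightarrow> bool" where
  "grad_or_subgrad \<phi> x v \<longleftrightarrow>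
     (if \<phi> differentiable (at x) then GDERIV \<phi> x :> v else v \<in> subdifferential \<phi> x)"

definition effective_domain :: "('a \<Rightarrow> ereal) \<Rightarrow> 'a set" where
  "effective_domain h = {x. h x < \<infinity>}"

definition proper_fun :: "('a \<Rightarrow> ereal) \<Rightarrow> bool" where
  "proper_fun h \<longleftrightarrow> (\<forall>x. h x \<noteq> - \<infinity>) \<and> effective_domain h \<noteq> {}"

text \<open>Only used together with \<^const>\<open>proper_fun\<close>, so that no sum of opposite infinities
  occurs on the right-hand side.\<close>
definition convex_fun :: "('a::real_vector \<Rightarrow> ereal) \<Rightarrow> bool" where
  "convex_fun h \<longleftrightarrow> (\<forall>x y. \<forall>u\<in>{0..1::real}.
     h ((1 - u) *\<^sub>R x + u *\<^sub>R y) \<le> ereal (1 - u) * h x + ereal u * h y)"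

definition lower_semicont :: "('a::topological_space \<Rightarrow> ereal) \<Rightarrow> bool" where
  "lower_semicont h \<longleftrightarrow> (\<forall>x. h x \<le> Liminf (at x) h)"

text \<open>The objective minimized in one iteration, with gradient estimate \<open>g\<close>, scaling \<open>s\<close> and
  previous iterate \<open>z\<close>.\<close>
definition prox_objective :: "('a::real_inner \<Rightarrow> ereal) \<Rightarrow> real \<Rightarrow> 'a \<Rightarrow> real \<Rightarrow> 'a \<Rightarrow> 'a \<Rightarrow> ereal" where
  "prox_objective h \<eta> g s z x = ereal (g \<bullet> x + s / (2 * \<eta>) * (norm (x - z))\<^sup>2) + h x"

text \<open>The sigma-algebra generated by the samples drawn before iteration \<open>k\<close>, iterations being
  numbered from 1; it is trivial for \<open>k = 1\<close>.\<close>
definition history :: "'w measure \<Rightarrow> 's measure \<Rightarrow> (nat \<Rightarrow> 'w \<Rightarrow> 's) \<Rightarrow> nat \<Rightarrow> 'w measure" where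
  "history M P \<xi> k =
     vimage_algebra (space M) (\<lambda>\<omega>. \<lambda>i\<in>{1..<k}. \<xi> i \<omega>) (\<Pi>\<^sub>M i\<in>{1..<k}. P)"

text \<open>Conditional expectation of an integrable random vector, taken coordinatewise.\<close>
definition vec_cond_exp :: "'w measure \<Rightarrow> 'w measure \<Rightarrow> ('w \<Rightarrow> 'a::euclidean_space) \<Rightarrow> 'w \<Rightarrow> 'a" where
  "vec_cond_exp M F X \<omega> = (\<Sum>b\<in>Basis. real_cond_exp M F (\<lambda>\<omega>'. X \<omega>' \<bullet> b) \<omega> *\<^sub>R b)"

definition running_mean :: "(nat \<Rightarrow> 'a::real_vector) \<Rightarrow> nat \<Rightarrow> 'a" where
  "running_mean x t = (1 / real t) *\<^sub>R (\<Sum>k=1..t. x (k + 1))"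

text \<open>An explicit admissible constant, with \<open>\<Delta>\<close> standing for the initial gap.  The dimension is
  represented by a type and cannot be quantified inside a formula, so an existentially
  quantified constant could depend on it; a closed formula rules this out.

  Write \<open>d k = norm (x (k+1) - x k)\<close>, let \<open>n k\<close> be the norm of the noise of \<open>g k\<close>, and
  \<open>Q\<close> the expectation of the sum of \<open>(2*G + n k) * d k\<close> over \<open>k \<le> t\<close>.  Comparing the objective
  values at \<open>x (k+1)\<close> with those at \<open>x k\<close> and at the minimizer bounds the expectation of
  \<open>S (t+1)\<close> by \<open>\<gamma> + (\<Delta> + Q) / (2*\<eta>)\<close>, and that of the summed suboptimality by \<open>Q\<close> plus
  \<open>D\<^sup>2 / (2*\<eta>)\<close> times the same quantity.  The sum of the \<open>(d k)\<^sup>2\<close> is at most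
  \<open>2 * (\<eta>\<^sup>2 + D\<^sup>2) * ln (S (t+1) / \<gamma>)\<close>, whence the definition of \<open>a\<close> and \<open>p\<close>.\<close>
definition rate_const :: "real \<Rightarrow> real \<Rightarrow> real \<Rightarrow> real \<Rightarrow> real \<Rightarrow> real" where
  "rate_const G \<gamma> \<eta> D \<Delta> =
     (let a = 1 + (\<Delta> + 2 * D * (2 * G + 1)) / (2 * \<eta> * \<gamma>);
          p = (3 * G + 2) * sqrt (2 * (\<eta>\<^sup>2 + D\<^sup>2) * (1 + log 2 a))
      in p * (1 + D\<^sup>2 / (4 * \<eta>\<^sup>2)) + D\<^sup>2 / \<eta> * (\<gamma> + \<Delta> / (2 * \<eta>)))"

text \<open>The argument of the logarithm is \<open>(1 + \<sigma>\<^sup>2) * t\<close> as soon as this is at least 2, so for every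
  \<open>t \<ge> 2\<close>, and for \<open>t = 1\<close> when \<open>\<sigma> \<ge> 1\<close>.  Without the cut-off no constant independent of \<open>\<sigma>\<close>
  works at \<open>t = 1\<close>: a noiseless method satisfies the variance bound with every \<open>\<sigma> > 0\<close>, and
  \<open>ln (1 + \<sigma>\<^sup>2)\<close> tends to 0 with \<open>\<sigma>\<close> whereas the gap at \<open>x 2\<close> need not vanish.\<close>
definition rate :: "real \<Rightarrow> nat \<Rightarrow> real" where
  "rate \<sigma> t = (1 + \<sigma>) * sqrt (ln (max 2 ((1 + \<sigma>\<^sup>2) * real t))) / sqrt (real t)"

end

theory Submission
  imports Defs
begin

text \<open>Write \<open>d k\<close> for the length of step \<open>k\<close>, \<open>e k\<close> for the noise of \<open>g k\<close> and
  \<open>W k = (2 * G + norm (e k)) * d k\<close>.  The three-point inequality of the proximal step, used with the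
  previous iterate as comparison point, telescopes to a bound on \<open>S (t + 1)\<close> by the sum of the
  \<open>W k\<close>.  Used with the minimizer, and with the weights \<open>S k\<close> summed by parts, it bounds the summed
  gaps by the sum of the \<open>W k\<close>, a multiple of \<open>S (t + 1)\<close>, and a martingale term of mean zero.
  It remains to estimate the expectation \<open>Q\<close> of the sum of the \<open>W k\<close>.  The recursion for \<open>S\<close> makes
  the sum of the \<open>(d k)\<^sup>2\<close> at most a multiple of \<open>ln (S (t + 1) / S 1)\<close>.  Since
  \<open>ln y \<le> ln c + y / c - 1\<close>, with \<open>c\<close> an a priori bound on the mean of \<open>S (t + 1) / S 1\<close>, the
  expectation of this logarithm is at most \<open>ln c\<close>, which is of order \<open>ln ((1 + \<sigma>\<^sup>2) * t)\<close>;
  Cauchy-Schwarz then bounds \<open>Q\<close>.\<close>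

section \<open>Extended-valued convex functions and the three-point inequality\<close>

lemma ereal_real_on_domain:
  assumes "proper_fun h" "x \<in> effective_domain h"
  shows "ereal (real_of_ereal (h x)) = h x"
  using assms by (cases "h x") (auto simp: proper_fun_def effective_domain_def)

text \<open>On the domain all values are finite, so the extended inequality becomes a real one. Its
  finite right-hand side also keeps segments inside the domain, which is the convexity of the set
  that \<open>convex_on\<close> demands.\<close>

lemma convex_on_effective_domain:
  fixes h :: "'a::real_vector \<Rightarrow> ereal"
  assumes "convex_fun h" "proper_fun h"
  shows "convex_on (effective_domain h) (\<lambda>x. real_of_ereal (h x))"
proof -
  have le: "h ((1 - u) *\<^sub>R x + u *\<^sub>R y)
      \<le> ereal ((1 - u) * real_of_ereal (h x) + u * real_of_ereal (h y))"
    if "x \<in> effective_domain h" "y \<in> effective_domain h" "0 \<le> u" "u \<le> 1" for x y u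
  proof -
    have "h ((1 - u) *\<^sub>R x + u *\<^sub>R y) \<le> ereal (1 - u) * h x + ereal u * h y"
      using assms(1) that by (auto simp: convex_fun_def)
    also have "\<dots> = ereal ((1 - u) * real_of_ereal (h x) + u * real_of_ereal (h y))"
      using that ereal_real_on_domain[OF assms(2), of x] ereal_real_on_domain[OF assms(2), of y]
      by (metis plus_ereal.simps(1) times_ereal.simps(1))
    finally show ?thesis .
  qed
  have dom: "(1 - u) *\<^sub>R x + u *\<^sub>R y \<in> effective_domain h"
    if "x \<in> effective_domain h" "y \<in> effective_domain h" "0 \<le> u" "u \<le> 1" for x y u
    using le[OF that] by (auto simp: effective_domain_def)
  show ?thesis
  proof (rule convex_onI)
    fix u x y assume u: "0 < (u::real)" "u < 1"
      and xy: "x \<in> effective_domain h" "y \<in> effective_domain h"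
    have "ereal (real_of_ereal (h ((1 - u) *\<^sub>R x + u *\<^sub>R y)))
        \<le> ereal ((1 - u) * real_of_ereal (h x) + u * real_of_ereal (h y))"
      using le[OF xy] dom[OF xy] ereal_real_on_domain[OF assms(2)] u by (metis less_imp_le)
    then show "real_of_ereal (h ((1 - u) *\<^sub>R x + u *\<^sub>R y))
        \<le> (1 - u) * real_of_ereal (h x) + u * real_of_ereal (h y)"
      by simp
  next
    show "convex (effective_domain h)"
      unfolding convex_alt using dom by blast
  qed
qed

lemma is_arg_min_prox_domain:
  assumes "proper_fun h" "is_arg_min (prox_objective h \<eta> g s z) (\<lambda>_. True) u"
  shows "u \<in> effective_domain h"
proof (rule ccontr)
  assume "u \<notin> effective_domain h"
  then have "prox_objective h \<eta> g s z u = \<infinity>"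
    by (simp add: effective_domain_def prox_objective_def)
  moreover obtain y where "y \<in> effective_domain h"
    using assms(1) by (auto simp: proper_fun_def)
  moreover from this have "prox_objective h \<eta> g s z y < \<infinity>"
    by (simp add: effective_domain_def prox_objective_def)
  ultimately show False
    using assms(2) by (auto simp: is_arg_min_def)
qed

text \<open>Strong convexity of the squared norm in exact form; the negative term is the source of
  the extra quadratic in the three-point inequality.\<close>

lemma norm_diff_convex_combination:
  fixes u y z :: "'a::real_inner"
  shows "(norm ((1 - l) *\<^sub>R u + l *\<^sub>R y - z))\<^sup>2
    = (1 - l) * (norm (u - z))\<^sup>2 + l * (norm (y - z))\<^sup>2 - l * (1 - l) * (norm (y - u))\<^sup>2"
proof -
  have "(1 - l) *\<^sub>R u + l *\<^sub>R y - z = (1 - l) *\<^sub>R (u - z) + l *\<^sub>R (y - z)"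
    by (simp add: algebra_simps)
  moreover have "y - u = (y - z) - (u - z)" by simp
  ultimately show ?thesis
    unfolding power2_norm_eq_inner
    by (simp only: inner_add_left inner_add_right inner_diff_left inner_diff_right
        inner_scaleR_left inner_scaleR_right) (simp add: inner_commute algebra_simps)
qed

text \<open>The minimizer \<open>u\<close> is compared with the points of the segment from
  \<open>u\<close> to \<open>y\<close>. Convexity of \<open>h\<close> and the exact expansion of the
  quadratic leave a common factor \<open>l\<close>; dividing by it and letting \<open>l\<close> tend
  to 0 gives the claim, without any subgradient of \<open>h\<close>.\<close>

lemma prox_three_point:
  fixes h :: "'a::real_inner \<Rightarrow> ereal"
  assumes "convex_fun h" "proper_fun h"
    and min: "is_arg_min (prox_objective h \<eta> g s z) (\<lambda>_. True) u"
    and y: "y \<in> effective_domain h"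
  shows "g \<bullet> u + s / (2 * \<eta>) * (norm (u - z))\<^sup>2 + real_of_ereal (h u)
      + s / (2 * \<eta>) * (norm (y - u))\<^sup>2
    \<le> g \<bullet> y + s / (2 * \<eta>) * (norm (y - z))\<^sup>2 + real_of_ereal (h y)"
proof -
  define c where "c = s / (2 * \<eta>)"
  define A where "A = g \<bullet> u + c * (norm (u - z))\<^sup>2 + real_of_ereal (h u)"
  define B where "B = g \<bullet> y + c * (norm (y - z))\<^sup>2 + real_of_ereal (h y)"
  have u: "u \<in> effective_domain h"
    by (rule is_arg_min_prox_domain[OF assms(2) min])
  have conv: "convex_on (effective_domain h) (\<lambda>x. real_of_ereal (h x))"
    by (rule convex_on_effective_domain[OF assms(1,2)])
  have step: "A + c * (1 - l) * (norm (y - u))\<^sup>2 \<le> B" if l: "0 < l" "l < 1" for l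
  proof -
    define w where "w = (1 - l) *\<^sub>R u + l *\<^sub>R y"
    have w: "w \<in> effective_domain h"
      using conv u y l unfolding w_def convex_on_def convex_alt by auto
    have hw: "real_of_ereal (h w) \<le> (1 - l) * real_of_ereal (h u) + l * real_of_ereal (h y)"
      using convex_onD[OF conv, of l u y] u y l by (simp add: w_def)
    have nw: "(norm (w - z))\<^sup>2 = (1 - l) * (norm (u - z))\<^sup>2 + l * (norm (y - z))\<^sup>2
        - l * (1 - l) * (norm (y - u))\<^sup>2"
      unfolding w_def by (rule norm_diff_convex_combination)
    have gw: "g \<bullet> w = (1 - l) * (g \<bullet> u) + l * (g \<bullet> y)"
      by (simp add: w_def inner_add_right)
    have "prox_objective h \<eta> g s z u \<le> prox_objective h \<eta> g s z w"
      using min by (auto simp: is_arg_min_def not_less)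
    then have "ereal A \<le> ereal (g \<bullet> w + c * (norm (w - z))\<^sup>2 + real_of_ereal (h w))"
      unfolding prox_objective_def A_def c_def
      using ereal_real_on_domain[OF assms(2) u] ereal_real_on_domain[OF assms(2) w]
      by (metis plus_ereal.simps(1))
    then have "A \<le> g \<bullet> w + c * (norm (w - z))\<^sup>2 + real_of_ereal (h w)"
      by simp
    also have "\<dots> \<le> (1 - l) * A + l * B - c * (l * (1 - l) * (norm (y - u))\<^sup>2)"
      using hw unfolding nw gw A_def B_def by (simp add: algebra_simps)
    finally have "l * (A + c * (1 - l) * (norm (y - u))\<^sup>2) \<le> l * B"
      by (simp add: algebra_simps)
    then show ?thesis using l by simp
  qed
  \<comment> \<open>The limit removes the factor \<open>1 - l\<close>, so that the quadratic keeps
    its full coefficient.\<close>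
  have "((\<lambda>l. A + c * (1 - l) * (norm (y - u))\<^sup>2) \<longlongrightarrow> A + c * (1 - 0) * (norm (y - u))\<^sup>2)
      (at_right 0)"
    by (intro tendsto_intros)
  moreover have "eventually (\<lambda>l. A + c * (1 - l) * (norm (y - u))\<^sup>2 \<le> B) (at_right 0)"
    unfolding eventually_at_right_field using step by (intro exI[of _ 1]) auto
  ultimately have "A + c * (1 - 0) * (norm (y - u))\<^sup>2 \<le> B"
    by (rule tendsto_upperbound) simp
  then show ?thesis by (simp add: A_def B_def c_def)
qed

section \<open>Stability and measurability of the proximal map\<close>

text \<open>Each minimizer serves as comparison point in the three-point inequality of the other; in
  the sum the values of \<open>h\<close> cancel. The bound contains \<open>u\<close> but not
  \<open>u'\<close>, so it tends to 0 as the primed data approach the unprimed ones. Equal data give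
  uniqueness of the minimizer.\<close>

lemma prox_perturbation:
  fixes h :: "'a::real_inner \<Rightarrow> ereal"
  assumes "convex_fun h" "proper_fun h" "\<eta> > 0" "s' > 0"
    and u: "is_arg_min (prox_objective h \<eta> g s z) (\<lambda>_. True) u"
    and u': "is_arg_min (prox_objective h \<eta> g' s' z') (\<lambda>_. True) u'"
  shows "norm (u' - u)
    \<le> (\<eta> * norm (g - g') + \<bar>s - s'\<bar> * norm u + norm (s *\<^sub>R z - s' *\<^sub>R z')) / s'"
proof -
  have "2 * \<eta> * (g \<bullet> u + s / (2 * \<eta>) * (norm (u - z))\<^sup>2 + real_of_ereal (h u)
      + s / (2 * \<eta>) * (norm (u' - u))\<^sup>2)
    \<le> 2 * \<eta> * (g \<bullet> u' + s / (2 * \<eta>) * (norm (u' - z))\<^sup>2 + real_of_ereal (h u'))"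
    using prox_three_point[OF assms(1,2) u is_arg_min_prox_domain[OF assms(2) u']] assms(3)
    by (intro mult_left_mono) auto
  then have 1: "2 * \<eta> * (g \<bullet> u) + s * (norm (u - z))\<^sup>2 + 2 * \<eta> * real_of_ereal (h u)
      + s * (norm (u' - u))\<^sup>2
    \<le> 2 * \<eta> * (g \<bullet> u') + s * (norm (u' - z))\<^sup>2 + 2 * \<eta> * real_of_ereal (h u')"
    using assms(3) by (simp add: distrib_left)
  have "2 * \<eta> * (g' \<bullet> u' + s' / (2 * \<eta>) * (norm (u' - z'))\<^sup>2 + real_of_ereal (h u')
      + s' / (2 * \<eta>) * (norm (u - u'))\<^sup>2)
    \<le> 2 * \<eta> * (g' \<bullet> u + s' / (2 * \<eta>) * (norm (u - z'))\<^sup>2 + real_of_ereal (h u))"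
    using prox_three_point[OF assms(1,2) u' is_arg_min_prox_domain[OF assms(2) u]] assms(3)
    by (intro mult_left_mono) auto
  then have 2: "2 * \<eta> * (g' \<bullet> u') + s' * (norm (u' - z'))\<^sup>2 + 2 * \<eta> * real_of_ereal (h u')
      + s' * (norm (u - u'))\<^sup>2
    \<le> 2 * \<eta> * (g' \<bullet> u) + s' * (norm (u - z'))\<^sup>2 + 2 * \<eta> * real_of_ereal (h u)"
    using assms(3) by (simp add: distrib_left)
  \<comment> \<open>\<open>q\<close> is \<eta> times the difference, at \<open>u\<close>, of the
    gradients of the two smooth parts.\<close>
  define q where "q = \<eta> *\<^sub>R (g - g') + (s - s') *\<^sub>R u - (s *\<^sub>R z - s' *\<^sub>R z')"
  have e: "s * (norm (u' - z))\<^sup>2 - s * (norm (u - z))\<^sup>2 - s * (norm (u' - u))\<^sup>2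
     + s' * (norm (u - z'))\<^sup>2 - s' * (norm (u' - z'))\<^sup>2 - s' * (norm (u - u'))\<^sup>2
     + 2 * \<eta> * (g \<bullet> u') - 2 * \<eta> * (g \<bullet> u) + 2 * \<eta> * (g' \<bullet> u) - 2 * \<eta> * (g' \<bullet> u')
     = 2 * (q \<bullet> (u' - u)) - 2 * s' * (norm (u' - u))\<^sup>2"
    unfolding power2_norm_eq_inner q_def
    by (simp add: inner_diff_left inner_diff_right inner_add_left inner_commute algebra_simps)
  have "s' * (norm (u' - u))\<^sup>2 \<le> q \<bullet> (u' - u)"
    using 1 2 e by linarith
  also have "\<dots> \<le> norm q * norm (u' - u)" by (rule norm_cauchy_schwarz)
  finally have "s' * norm (u' - u) \<le> norm q"
    by (cases "norm (u' - u) = 0") (auto simp: power2_eq_square)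
  also have "norm q \<le> \<eta> * norm (g - g') + \<bar>s - s'\<bar> * norm u + norm (s *\<^sub>R z - s' *\<^sub>R z')"
    unfolding q_def using assms(3)
    by (metis (no_types, lifting) abs_of_pos add_right_mono norm_scaleR norm_triangle_ineq
        norm_triangle_ineq4 order_trans)
  finally show ?thesis using assms(4) by (simp add: field_simps)
qed

text \<open>Existence of a minimizer is not needed: it suffices to know the map where one exists.\<close>
lemma borel_measurable_prox:
  fixes h :: "'a::euclidean_space \<Rightarrow> ereal"
  assumes "convex_fun h" "proper_fun h" "\<eta> > 0"
    and [measurable]: "g \<in> borel_measurable N" "s \<in> borel_measurable N" "z \<in> borel_measurable N"
    and s: "\<And>\<omega>. \<omega> \<in> space N \<Longrightarrow> s \<omega> > 0"
    and u: "\<And>\<omega>. \<omega> \<in> space N \<Longrightarrow>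
      is_arg_min (prox_objective h \<eta> (g \<omega>) (s \<omega>) (z \<omega>)) (\<lambda>_. True) (u \<omega>)"
  shows "u \<in> borel_measurable N"
proof -
  \<comment> \<open>The data for which a minimizer exists. \<open>T\<close> selects one there, and
    the perturbation bound makes \<open>T\<close> continuous relative to \<open>A\<close>, hence
    measurable on the restricted Borel space.\<close>
  define A where "A = {(g, s, z). s > 0 \<and> (\<exists>u. is_arg_min (prox_objective h \<eta> g s z) (\<lambda>_. True) u)}"
  define T where "T = (\<lambda>(g, s, z). SOME u. is_arg_min (prox_objective h \<eta> g s z) (\<lambda>_. True) u)"
  have T: "is_arg_min (prox_objective h \<eta> (fst p) (fst (snd p)) (snd (snd p))) (\<lambda>_. True) (T p)"
    if "p \<in> A" for p
    using that unfolding A_def T_def by (auto split: prod.splits intro: someI)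
  have "continuous_on A T"
    unfolding continuous_on_def
  proof
    fix p assume p: "p \<in> A"
    define B where "B = (\<lambda>p'. (\<eta> * norm (fst p - fst p') + \<bar>fst (snd p) - fst (snd p')\<bar> * norm (T p)
      + norm (fst (snd p) *\<^sub>R snd (snd p) - fst (snd p') *\<^sub>R snd (snd p'))) / fst (snd p'))"
    have p0: "fst (snd p) \<noteq> 0" using p by (auto simp: A_def)
    have "(B \<longlongrightarrow> B p) (at p within A)"
      unfolding B_def by (intro tendsto_intros p0)
    then have B: "(B \<longlongrightarrow> 0) (at p within A)" by (simp add: B_def)
    have "norm (T p' - T p) \<le> B p'" if "p' \<in> A" for p'
      unfolding B_def
      by (rule prox_perturbation[OF assms(1-3) _ T[OF p] T[OF that]]) (use that in \<open>auto simp: A_def\<close>)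
    then have "eventually (\<lambda>p'. norm (T p' - T p) \<le> B p') (at p within A)"
      by (auto simp: eventually_at_filter)
    then have "((\<lambda>p'. T p' - T p) \<longlongrightarrow> 0) (at p within A)"
      by (rule Lim_null_comparison) (rule B)
    then show "(T \<longlongrightarrow> T p) (at p within A)" by (simp add: Lim_null[symmetric])
  qed
  then have T_meas: "T \<in> borel_measurable (restrict_space borel A)"
    by (rule borel_measurable_continuous_on_restrict)
  have in_A: "(g \<omega>, s \<omega>, z \<omega>) \<in> A" if "\<omega> \<in> space N" for \<omega>
    using s[OF that] u[OF that] by (auto simp: A_def)
  have "(\<lambda>\<omega>. (g \<omega>, s \<omega>, z \<omega>)) \<in> measurable N borel" by measurable
  then have "(\<lambda>\<omega>. (g \<omega>, s \<omega>, z \<omega>)) \<in> measurable N (restrict_space borel A)"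
    by (intro measurable_restrict_space2) (use in_A in auto)
  then have "(\<lambda>\<omega>. T (g \<omega>, s \<omega>, z \<omega>)) \<in> borel_measurable N"
    by (rule measurable_compose) (rule T_meas)
  \<comment> \<open>With identical data the perturbation bound is 0, so the selected minimizer is
    the given one.\<close>
  moreover have "T (g \<omega>, s \<omega>, z \<omega>) = u \<omega>" if "\<omega> \<in> space N" for \<omega>
    using prox_perturbation[OF assms(1-3) s[OF that] u[OF that] T[OF in_A[OF that], simplified]]
    by simp
  ultimately show ?thesis by (subst measurable_cong[of N u "\<lambda>\<omega>. T (g \<omega>, s \<omega>, z \<omega>)"]) auto
qed

section \<open>Deterministic estimates for one step and along a sample path\<close>

text \<open>The subgradient inequality is tested at \<open>z + v\<close>, where the Lipschitz
  condition limits the increase to \<open>G * norm v\<close>.\<close>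

lemma norm_subdifferential_le:
  assumes "G-lipschitz_on UNIV \<phi>" "v \<in> subdifferential \<phi> z"
  shows "norm v \<le> G"
proof -
  have "\<phi> z + v \<bullet> v \<le> \<phi> (z + v)"
    using assms(2) by (auto simp: subdifferential_def dest: spec[of _ "z + v"])
  moreover have "\<phi> (z + v) - \<phi> z \<le> G * norm v"
    using lipschitz_onD[OF assms(1), of "z + v" z] by (simp add: dist_norm)
  ultimately have "norm v * norm v \<le> G * norm v"
    by (simp add: power2_norm_eq_inner[symmetric] power2_eq_square)
  moreover have "0 \<le> G" by (rule lipschitz_on_nonneg[OF assms(1)])
  ultimately show ?thesis by (cases "norm v = 0") auto
qed

text \<open>Both bounds are the three-point inequality, with \<open>z\<close> and with
  \<open>y\<close> as comparison point. For \<open>z\<close> the two quadratic terms on the left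
  coincide, whence \<open>s / \<eta>\<close> instead of \<open>s / (2 * \<eta>)\<close>. Of the two
  \<open>G\<close>, one bounds the change of \<open>f\<close> from \<open>z\<close> to
  \<open>u\<close>, the other the norm of \<open>v\<close>; the rest of \<open>g\<close> is
  noise.\<close>

lemma prox_step_bounds:
  fixes h :: "'a::real_inner \<Rightarrow> ereal" and f :: "'a \<Rightarrow> real"
  assumes "convex_fun h" "proper_fun h" and lip: "G-lipschitz_on UNIV f" and "\<eta> > 0" "s > 0"
    and u: "is_arg_min (prox_objective h \<eta> g s z) (\<lambda>_. True) u"
    and v: "v \<in> subdifferential f z"
    and \<Phi>: "\<And>y. \<Phi> y = f y + real_of_ereal (h y)"
  shows "z \<in> effective_domain h \<Longrightarrow>
      s / \<eta> * (norm (u - z))\<^sup>2 + \<Phi> u \<le> \<Phi> z + (2 * G + norm (g - v)) * norm (u - z)"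
    and "y \<in> effective_domain h \<Longrightarrow>
      \<Phi> u - \<Phi> y \<le> (2 * G + norm (g - v)) * norm (u - z) - (g - v) \<bullet> (z - y)
        + s / (2 * \<eta>) * ((norm (z - y))\<^sup>2 - (norm (u - y))\<^sup>2)"
proof -
  have fu: "f u \<le> f z + G * norm (u - z)"
    using lipschitz_onD[OF lip, of u z] by (simp add: dist_norm abs_le_iff)
  have "v \<bullet> (z - u) \<le> G * norm (u - z)"
    using norm_cauchy_schwarz[of v "z - u"] norm_subdifferential_le[OF lip v]
    by (metis mult_right_mono norm_ge_zero norm_minus_commute order_trans)
  moreover have "(g - v) \<bullet> (z - u) \<le> norm (g - v) * norm (u - z)"
    using norm_cauchy_schwarz[of "g - v" "z - u"] by (simp add: norm_minus_commute)
  ultimately have gu: "g \<bullet> (z - u) \<le> (G + norm (g - v)) * norm (u - z)"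
    by (simp add: inner_diff_left algebra_simps)
  show "s / \<eta> * (norm (u - z))\<^sup>2 + \<Phi> u \<le> \<Phi> z + (2 * G + norm (g - v)) * norm (u - z)"
    if "z \<in> effective_domain h"
  proof -
    have "g \<bullet> u + s / (2 * \<eta>) * (norm (u - z))\<^sup>2 + real_of_ereal (h u)
        + s / (2 * \<eta>) * (norm (u - z))\<^sup>2 \<le> g \<bullet> z + real_of_ereal (h z)"
      using prox_three_point[OF assms(1,2) u that] by (simp add: norm_minus_commute)
    moreover have "s / (2 * \<eta>) * (norm (u - z))\<^sup>2 + s / (2 * \<eta>) * (norm (u - z))\<^sup>2
        = s / \<eta> * (norm (u - z))\<^sup>2" by simp
    ultimately show ?thesis
      using fu gu by (simp add: \<Phi> inner_diff_right algebra_simps)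
  qed
  show "\<Phi> u - \<Phi> y \<le> (2 * G + norm (g - v)) * norm (u - z) - (g - v) \<bullet> (z - y)
        + s / (2 * \<eta>) * ((norm (z - y))\<^sup>2 - (norm (u - y))\<^sup>2)"
    if "y \<in> effective_domain h"
  proof -
    have "f z + v \<bullet> (y - z) \<le> f y" using v by (auto simp: subdifferential_def)
    moreover have "g \<bullet> u + real_of_ereal (h u) + s / (2 * \<eta>) * (norm (u - y))\<^sup>2
        \<le> g \<bullet> y + s / (2 * \<eta>) * (norm (z - y))\<^sup>2 + real_of_ereal (h y)"
    proof -
      have "0 \<le> s / (2 * \<eta>) * (norm (u - z))\<^sup>2" using assms(4,5) by simp
      then show ?thesis
        using prox_three_point[OF assms(1,2) u that] by (simp add: norm_minus_commute)
    qed
    ultimately show ?thesis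
      using fu gu by (simp add: \<Phi> inner_diff_right inner_diff_left algebra_simps)
  qed
qed

text \<open>With \<open>q = d\<^sup>2 / \<eta>\<^sup>2\<close> the new scaling is
  \<open>s * sqrt (1 + q)\<close>. The upper bound is \<open>sqrt (1 + q) \<le> 1 + q / 2\<close>.
  The logarithmic bound rests on \<open>q / (1 + q) \<le> ln (1 + q)\<close>, with the resulting
  denominator \<open>\<eta>\<^sup>2 + d\<^sup>2\<close> controlled through \<open>D\<close>.\<close>

lemma adaptive_scaling_step:
  fixes s s' d \<eta> :: real
  assumes "\<eta> > 0" "s > 0" "s' > 0" "s'\<^sup>2 = s\<^sup>2 * (1 + d\<^sup>2 / \<eta>\<^sup>2)"
  shows "s \<le> s'"
    and "s' \<le> s + s * d\<^sup>2 / (2 * \<eta>\<^sup>2)"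
    and "\<bar>d\<bar> \<le> D \<Longrightarrow> d\<^sup>2 \<le> 2 * (\<eta>\<^sup>2 + D\<^sup>2) * (ln s' - ln s)"
proof -
  define q where "q = d\<^sup>2 / \<eta>\<^sup>2"
  have q: "q \<ge> 0" by (simp add: q_def)
  have s': "s'\<^sup>2 = s\<^sup>2 * (1 + q)" using assms(4) by (simp add: q_def)
  have "s\<^sup>2 \<le> s'\<^sup>2" unfolding s' using q by (simp add: mult_le_cancel_left1)
  then show "s \<le> s'" using assms(3) power2_le_imp_le by (metis less_imp_le)
  have "s'\<^sup>2 \<le> (s * (1 + q / 2))\<^sup>2"
    unfolding s' power_mult_distrib
    by (intro mult_left_mono) (auto simp: power2_eq_square algebra_simps)
  then have "s' \<le> s * (1 + q / 2)"
    by (rule power2_le_imp_le) (use q assms(2) in auto)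
  then show "s' \<le> s + s * d\<^sup>2 / (2 * \<eta>\<^sup>2)"
    by (simp add: q_def algebra_simps)
  show "d\<^sup>2 \<le> 2 * (\<eta>\<^sup>2 + D\<^sup>2) * (ln s' - ln s)" if "\<bar>d\<bar> \<le> D"
  proof -
    have "2 * ln s' = ln (s\<^sup>2 * (1 + q))"
      using assms(3) s' by (metis ln_realpow of_nat_numeral)
    also have "\<dots> = 2 * ln s + ln (1 + q)"
      using assms(2) q by (simp add: ln_mult ln_realpow)
    finally have l: "2 * (ln s' - ln s) = ln (1 + q)" by simp
    have "ln (1 / (1 + q)) \<le> 1 / (1 + q) - 1"
      using q by (intro ln_le_minus_one) auto
    then have "q / (1 + q) \<le> ln (1 + q)"
      using q by (simp add: ln_div field_simps)
    moreover have "q / (1 + q) = d\<^sup>2 / (\<eta>\<^sup>2 + d\<^sup>2)"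
      using assms(1) by (simp add: q_def field_simps)
    ultimately have "d\<^sup>2 \<le> (\<eta>\<^sup>2 + d\<^sup>2) * ln (1 + q)"
      using assms(1) by (simp add: field_simps add_pos_nonneg)
    also have "\<dots> \<le> (\<eta>\<^sup>2 + D\<^sup>2) * ln (1 + q)"
      using q that by (intro mult_right_mono) (auto simp: abs_le_square_iff[symmetric])
    finally show ?thesis unfolding l[symmetric] by (simp add: algebra_simps)
  qed
qed

text \<open>Summation by parts with nondecreasing weights. The term \<open>a (t + 1)\<close> is kept
  on the right so that the induction closes: the weight may be raised because its factor
  \<open>B - a (t + 2)\<close> is nonnegative.\<close>

lemma sum_weighted_telescope_le:
  fixes S a :: "nat \<Rightarrow> real"
  assumes "\<And>k. k \<ge> 1 \<Longrightarrow> 0 \<le> S k" "\<And>k. k \<ge> 1 \<Longrightarrow> S k \<le> S (k + 1)"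
    and "\<And>k. k \<ge> 1 \<Longrightarrow> a k \<le> B"
  shows "(\<Sum>k=1..t. S k * (a k - a (k + 1))) \<le> (B - a (t + 1)) * S (t + 1)"
proof (induction t)
  case 0
  then show ?case using assms(1,3)[of 1] by simp
next
  case (Suc t)
  have "(\<Sum>k=1..Suc t. S k * (a k - a (k + 1))) \<le> (B - a (t + 2)) * S (t + 1)"
    using Suc by (simp add: algebra_simps)
  also have "\<dots> \<le> (B - a (t + 2)) * S (t + 2)"
    using assms(2)[of "t + 1"] assms(3)[of "t + 2"] by (intro mult_left_mono) auto
  finally show ?case by simp
qed

text \<open>Everything that holds on a single sample path. The noise \<open>g k - v k\<close> is
  arbitrary here; its inner products with \<open>x k - xs\<close> are left as they stand, to vanish
  later in expectation.\<close>

lemma adaptive_prox_path: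
  fixes h :: "'a::real_inner \<Rightarrow> ereal" and f :: "'a \<Rightarrow> real" and x g v :: "nat \<Rightarrow> 'a"
  assumes h: "convex_fun h" "proper_fun h" and lip: "G-lipschitz_on UNIV f" and "\<eta> > 0"
    and \<Phi>: "\<And>y. \<Phi> y = f y + real_of_ereal (h y)"
    and xs: "xs \<in> effective_domain h" "\<And>y. y \<in> effective_domain h \<Longrightarrow> \<Phi> xs \<le> \<Phi> y"
    and x1: "x 1 \<in> effective_domain h" and S1: "S 1 > 0"
    and x: "\<And>k. k \<ge> 1 \<Longrightarrow>
      is_arg_min (prox_objective h \<eta> (g k) (S k) (x k)) (\<lambda>_. True) (x (k + 1))"
    and S: "\<And>k. k \<ge> 1 \<Longrightarrow>
      (S (k + 1))\<^sup>2 = (S k)\<^sup>2 * (1 + (norm (x (k + 1) - x k))\<^sup>2 / \<eta>\<^sup>2) \<and> S (k + 1) > 0"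
    and v: "\<And>k. k \<ge> 1 \<Longrightarrow> v k \<in> subdifferential f (x k)"
    and D: "\<And>k. k \<ge> 1 \<Longrightarrow> norm (x (k + 1) - x k) \<le> D"
      "\<And>k. k \<ge> 1 \<Longrightarrow> norm (x k - xs) \<le> D"
    and W: "\<And>k. W k = (2 * G + norm (g k - v k)) * norm (x (k + 1) - x k)"
  shows "x (t + 1) \<in> effective_domain h"
    and "0 < S (t + 1)"
    and "S (t + 1) \<le> S 1 + (\<Phi> (x 1) - \<Phi> xs + (\<Sum>k=1..t. W k)) / (2 * \<eta>)"
    and "(\<Sum>k=1..t. \<Phi> (x (k + 1)) - \<Phi> xs)
      \<le> (\<Sum>k=1..t. W k) - (\<Sum>k=1..t. (g k - v k) \<bullet> (x k - xs)) + D\<^sup>2 / (2 * \<eta>) * S (t + 1)"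
    and "(\<Sum>k=1..t. (norm (x (k + 1) - x k))\<^sup>2) \<le> 2 * (\<eta>\<^sup>2 + D\<^sup>2) * ln (S (t + 1) / S 1)"
proof -
  have xdom: "x (k + 1) \<in> effective_domain h" for k
    using x1 x[of k] is_arg_min_prox_domain[OF h(2)] by (cases k) auto
  then show "x (t + 1) \<in> effective_domain h" .
  have Spos: "0 < S (k + 1)" for k
    using S1 S[of k] by (cases k) auto
  then show "0 < S (t + 1)" .
  have Spos': "0 < S k" if "k \<ge> 1" for k using Spos[of "k - 1"] that by simp
  have xdom': "x k \<in> effective_domain h" if "k \<ge> 1" for k using xdom[of "k - 1"] that by simp
  note st = adaptive_scaling_step[OF \<open>\<eta> > 0\<close> Spos' Spos conjunct1[OF S]]
  note bd = prox_step_bounds[OF h lip \<open>\<eta> > 0\<close> Spos' x v \<Phi>]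
  \<comment> \<open>The factor \<open>2 * \<eta>\<close> turns the bound on the increment of
    \<open>S\<close> into exactly the quadratic term of the first step bound, so that scaling and
    objective telescope together. The last objective value is then replaced by the minimum.\<close>
  have "2 * \<eta> * (S (t + 1) - S 1) + \<Phi> (x (t + 1)) \<le> \<Phi> (x 1) + (\<Sum>k=1..t. W k)"
  proof (induction t)
    case (Suc t)
    have "2 * \<eta> * (S (t + 2) - S (t + 1))
        \<le> 2 * \<eta> * (S (t + 1) * (norm (x (t + 2) - x (t + 1)))\<^sup>2 / (2 * \<eta>\<^sup>2))"
      using st(2)[of "t + 1"] \<open>\<eta> > 0\<close> by (intro mult_left_mono) auto
    also have "\<dots> = S (t + 1) / \<eta> * (norm (x (t + 2) - x (t + 1)))\<^sup>2"
      using \<open>\<eta> > 0\<close> by (simp add: power2_eq_square)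
    also have "\<dots> + \<Phi> (x (t + 2)) \<le> \<Phi> (x (t + 1)) + W (t + 1)"
      using bd(1)[of "t + 1"] xdom'[of "t + 1"] by (simp add: W)
    finally have "2 * \<eta> * (S (t + 2) - S (t + 1)) + \<Phi> (x (t + 2)) \<le> \<Phi> (x (t + 1)) + W (t + 1)"
      by simp
    with Suc show ?case by (simp add: algebra_simps)
  qed simp
  then have "2 * \<eta> * (S (t + 1) - S 1) \<le> \<Phi> (x 1) - \<Phi> xs + (\<Sum>k=1..t. W k)"
    using xs(2)[OF xdom[of t]] by simp
  then show "S (t + 1) \<le> S 1 + (\<Phi> (x 1) - \<Phi> xs + (\<Sum>k=1..t. W k)) / (2 * \<eta>)"
    using \<open>\<eta> > 0\<close> by (simp add: field_simps)
  have "(\<Sum>k=1..t. \<Phi> (x (k + 1)) - \<Phi> xs) \<le> (\<Sum>k=1..t. W k - (g k - v k) \<bullet> (x k - xs)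
      + 1 / (2 * \<eta>) * (S k * ((norm (x k - xs))\<^sup>2 - (norm (x (k + 1) - xs))\<^sup>2)))"
    using bd(2)[OF _ _ _ xs(1)] by (intro sum_mono) (simp add: W)
  also have "\<dots> = (\<Sum>k=1..t. W k) - (\<Sum>k=1..t. (g k - v k) \<bullet> (x k - xs))
      + 1 / (2 * \<eta>) * (\<Sum>k=1..t. S k * ((norm (x k - xs))\<^sup>2 - (norm (x (k + 1) - xs))\<^sup>2))"
    by (simp only: sum.distrib sum_subtractf sum_distrib_left)
  \<comment> \<open>Summation by parts with the squared distances to the minimizer, bounded by
    \<open>D\<^sup>2\<close>, as the sequence \<open>a\<close>.\<close>
  also have "(\<Sum>k=1..t. S k * ((norm (x k - xs))\<^sup>2 - (norm (x (k + 1) - xs))\<^sup>2))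
      \<le> (D\<^sup>2 - (norm (x (t + 1) - xs))\<^sup>2) * S (t + 1)"
    by (rule sum_weighted_telescope_le) (use Spos' st(1) D(2) in \<open>auto intro: less_imp_le power_mono\<close>)
  also have "\<dots> \<le> D\<^sup>2 * S (t + 1)"
    using Spos[of t] by (intro mult_right_mono) auto
  finally show "(\<Sum>k=1..t. \<Phi> (x (k + 1)) - \<Phi> xs)
      \<le> (\<Sum>k=1..t. W k) - (\<Sum>k=1..t. (g k - v k) \<bullet> (x k - xs)) + D\<^sup>2 / (2 * \<eta>) * S (t + 1)"
    using \<open>\<eta> > 0\<close> by (simp add: divide_right_mono)
  have "(\<Sum>k=1..t. (norm (x (k + 1) - x k))\<^sup>2)
      \<le> (\<Sum>k=1..t. 2 * (\<eta>\<^sup>2 + D\<^sup>2) * (ln (S (k + 1)) - ln (S k)))"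
    using st(3) D(1) by (intro sum_mono) auto
  also have "\<dots> = 2 * (\<eta>\<^sup>2 + D\<^sup>2) * (ln (S (t + 1)) - ln (S 1))"
    unfolding sum_distrib_left[symmetric] by (induction t) auto
  finally show "(\<Sum>k=1..t. (norm (x (k + 1) - x k))\<^sup>2) \<le> 2 * (\<eta>\<^sup>2 + D\<^sup>2) * ln (S (t + 1) / S 1)"
    using S1 Spos[of t] by (simp add: ln_div)
qed

section \<open>From moment bounds to the explicit rate\<close>

text \<open>Cauchy-Schwarz in weighted form: the choice \<open>\<epsilon> = sqrt V / sqrt A\<close>
  balances the two terms. The weighted form is additive in \<open>A\<close> and \<open>V\<close>, so
  it can be summed over iterations and integrated before \<epsilon> is chosen.\<close>

lemma sqrt_bound_from_weighted:
  fixes Q A V :: real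
  assumes "A > 0" "V > 0" "\<And>\<epsilon>. \<epsilon> > 0 \<Longrightarrow> Q \<le> (\<epsilon> * A + V / \<epsilon>) / 2"
  shows "Q \<le> sqrt A * sqrt V"
proof -
  have "Q \<le> (sqrt V / sqrt A * A + V / (sqrt V / sqrt A)) / 2"
    using assms by (intro assms(3)) auto
  also have "\<dots> = sqrt A * sqrt V"
    using assms(1,2) by (simp add: real_div_sqrt field_simps)
  finally show ?thesis .
qed

text \<open>A bootstrap on \<open>Q\<close>. The crude linear bound enters only through the choice
  of \<open>c\<close>, where it costs a logarithm, and makes \<open>V\<close> of order
  \<open>ln m\<close>; the weighted inequality \<open>Q_V\<close> then improves \<open>Q\<close> to
  order \<open>sqrt (t * ln m)\<close>.\<close>

lemma rate_const_bound:
  fixes G \<gamma> \<eta> D \<sigma> \<Delta> Q V :: real and t :: nat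
  assumes pos: "G \<ge> 0" "\<gamma> > 0" "\<eta> > 0" "D > 0" "\<sigma> > 0" "\<Delta> \<ge> 0" and t: "t \<ge> 1"
    and Q: "Q \<le> t * (D * (2 * G + \<sigma>))"
    and Q_V: "\<And>\<epsilon>. \<epsilon> > 0 \<Longrightarrow> Q \<le> (\<epsilon> * (t * (2 * G + \<sigma>)\<^sup>2) + V / \<epsilon>) / 2"
    and V: "\<And>c. c > 0 \<Longrightarrow>
      V \<le> 2 * (\<eta>\<^sup>2 + D\<^sup>2) * (ln c + (\<gamma> + (\<Delta> + Q) / (2 * \<eta>)) / (\<gamma> * c) - 1)"
  shows "(Q + D\<^sup>2 / (2 * \<eta>) * (\<gamma> + (\<Delta> + Q) / (2 * \<eta>))) / t \<le> rate_const G \<gamma> \<eta> D \<Delta> * rate \<sigma> t"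
proof -
  define a where "a = 1 + (\<Delta> + 2 * D * (2 * G + 1)) / (2 * \<eta> * \<gamma>)"
  define m where "m = max 2 ((1 + \<sigma>\<^sup>2) * real t)"
  define L where "L = sqrt (ln m)"
  define p0 where "p0 = sqrt (2 * (\<eta>\<^sup>2 + D\<^sup>2) * (1 + log 2 a))"
  have a: "a \<ge> 1" using pos by (simp add: a_def)
  have m: "m \<ge> 2" by (simp add: m_def)
  have la: "0 \<le> log 2 a" using a by simp
  have lnm: "0 < ln m" using m by simp
  \<comment> \<open>This lets \<open>m\<close> absorb all dependence on \<sigma> of the crude bound,
    so that \<open>a\<close> is free of \<sigma>.\<close>
  have \<sigma>1: "\<sigma> \<le> 1 + \<sigma>\<^sup>2"
    using zero_le_power2[of "\<sigma> - 1"] pos(5) by (simp add: power2_diff)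
  have "2 * G + \<sigma> \<le> (2 * G + 1) * (1 + \<sigma>\<^sup>2)"
    using \<sigma>1 mult_nonneg_nonneg[OF pos(1) zero_le_power2[of \<sigma>]] by (simp add: algebra_simps)
  then have "t * (2 * G + \<sigma>) \<le> t * ((2 * G + 1) * (1 + \<sigma>\<^sup>2))"
    by (intro mult_left_mono) auto
  also have "\<dots> = (2 * G + 1) * ((1 + \<sigma>\<^sup>2) * t)" by (simp only: mult_ac)
  also have "\<dots> \<le> (2 * G + 1) * m"
    using pos by (intro mult_left_mono) (auto simp: m_def)
  finally have "D * (t * (2 * G + \<sigma>)) \<le> D * ((2 * G + 1) * m)"
    using pos by (intro mult_left_mono) auto
  then have "Q \<le> D * (2 * G + 1) * m" using Q by (simp add: mult_ac)
  then have "\<Delta> + Q \<le> (\<Delta> + 2 * D * (2 * G + 1)) * m"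
  proof -
    have "\<Delta> \<le> \<Delta> * m" using pos m by (simp add: mult_le_cancel_left1)
    moreover have "0 \<le> D * (2 * G + 1) * m" using pos m by simp
    ultimately show ?thesis
      using \<open>Q \<le> D * (2 * G + 1) * m\<close> by (simp add: algebra_simps)
  qed
  then have "(\<Delta> + Q) / (2 * \<eta>) \<le> (\<Delta> + 2 * D * (2 * G + 1)) * m / (2 * \<eta>)"
    using pos by (intro divide_right_mono) auto
  also have "\<dots> = \<gamma> * ((a - 1) * m)" using pos by (simp add: a_def field_simps)
  finally have "\<gamma> + (\<Delta> + Q) / (2 * \<eta>) \<le> \<gamma> * (1 + (a - 1) * m)" by (simp add: algebra_simps)
  also have "\<dots> \<le> \<gamma> * (a * m)" using pos m by (intro mult_left_mono) (auto simp: algebra_simps)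
  finally have S: "(\<gamma> + (\<Delta> + Q) / (2 * \<eta>)) / (\<gamma> * (a * m)) \<le> 1"
    using pos a m by (simp add: divide_le_eq)
  \<comment> \<open>The choice \<open>c = a * m\<close> dominates the a priori bound on the scaling
    relative to \<gamma>, so the quotient is at most 1 and only the logarithm remains.\<close>
  have "V \<le> 2 * (\<eta>\<^sup>2 + D\<^sup>2) * (ln (a * m) + (\<gamma> + (\<Delta> + Q) / (2 * \<eta>)) / (\<gamma> * (a * m)) - 1)"
    using a m by (intro V) auto
  also have "\<dots> \<le> 2 * (\<eta>\<^sup>2 + D\<^sup>2) * ln (a * m)"
    using S by (intro mult_left_mono) auto
  also have "ln (a * m) \<le> (1 + log 2 a) * ln m"
  proof -
    \<comment> \<open>Here the cut-off at 2 in the rate is used: \<open>ln 2 \<le> ln m\<close>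
      turns the additive \<open>ln a\<close> into a multiple of \<open>ln m\<close>.\<close>
    have "ln a = log 2 a * ln 2" by (simp add: log_def)
    also have "\<dots> \<le> log 2 a * ln m" using la m by (intro mult_left_mono) auto
    finally show ?thesis using a m by (simp add: ln_mult algebra_simps)
  qed
  finally have V': "V \<le> 2 * (\<eta>\<^sup>2 + D\<^sup>2) * (1 + log 2 a) * ln m"
    by (simp add: mult_left_mono mult.assoc)
  have Vpos: "0 < 2 * (\<eta>\<^sup>2 + D\<^sup>2) * (1 + log 2 a) * ln m"
    using pos la lnm by (intro mult_pos_pos) (auto intro: add_pos_pos add_pos_nonneg)
  \<comment> \<open>The upper bound on \<open>V\<close> takes its place because the optimal
    \<epsilon> requires a positive quantity, while \<open>V\<close> itself may vanish.\<close>
  have "Q \<le> sqrt (t * (2 * G + \<sigma>)\<^sup>2) * sqrt (2 * (\<eta>\<^sup>2 + D\<^sup>2) * (1 + log 2 a) * ln m)"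
  proof (rule sqrt_bound_from_weighted)
    show "0 < t * (2 * G + \<sigma>)\<^sup>2" using pos t by (intro mult_pos_pos) auto
    show "Q \<le> (\<epsilon> * (t * (2 * G + \<sigma>)\<^sup>2) + 2 * (\<eta>\<^sup>2 + D\<^sup>2) * (1 + log 2 a) * ln m / \<epsilon>) / 2"
      if "\<epsilon> > 0" for \<epsilon>
      by (rule order_trans[OF Q_V[OF that]], intro divide_right_mono add_left_mono V') (use that in auto)
  qed (rule Vpos)
  also have "\<dots> = (2 * G + \<sigma>) * (sqrt t * (p0 * L))"
    using pos by (simp add: real_sqrt_mult p0_def L_def)
  also have "\<dots> \<le> ((3 * G + 2) * (1 + \<sigma>)) * (sqrt t * (p0 * L))"
  proof (rule mult_right_mono)
    show "2 * G + \<sigma> \<le> (3 * G + 2) * (1 + \<sigma>)"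
      using pos by (simp add: algebra_simps add_increasing)
    show "0 \<le> sqrt t * (p0 * L)" using la lnm by (simp add: p0_def L_def)
  qed
  finally have Q': "Q \<le> (3 * G + 2) * p0 * ((1 + \<sigma>) * L * sqrt t)" by (simp add: mult_ac)
  \<comment> \<open>A lower bound on the rate factor absorbs the terms that do not grow with
    \<open>t\<close>. The value 1/2 accounts for the coefficient \<open>D\<^sup>2 / \<eta>\<close>
    in \<open>rate_const\<close> where the estimate has
    \<open>D\<^sup>2 / (2 * \<eta>)\<close>.\<close>
  have "(1 / 2)\<^sup>2 \<le> ln (2::real)" using ln2_ge_two_thirds by (simp add: power2_eq_square)
  also have "\<dots> \<le> ln m" using m by simp
  finally have "1 / 2 \<le> L" unfolding L_def by (rule real_le_rsqrt)
  moreover have "1 * L * 1 \<le> (1 + \<sigma>) * L * sqrt t"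
    using pos t \<open>1 / 2 \<le> L\<close> by (intro mult_mono) auto
  ultimately have half: "1 / 2 \<le> (1 + \<sigma>) * L * sqrt t" by linarith
  have "Q + D\<^sup>2 / (2 * \<eta>) * (\<gamma> + (\<Delta> + Q) / (2 * \<eta>))
      = (1 + D\<^sup>2 / (4 * \<eta>\<^sup>2)) * Q + D\<^sup>2 / \<eta> * (\<gamma> + \<Delta> / (2 * \<eta>)) * (1 / 2)"
    using pos by (simp add: field_simps power2_eq_square)
  also have "\<dots> \<le> (1 + D\<^sup>2 / (4 * \<eta>\<^sup>2)) * ((3 * G + 2) * p0 * ((1 + \<sigma>) * L * sqrt t))
      + D\<^sup>2 / \<eta> * (\<gamma> + \<Delta> / (2 * \<eta>)) * ((1 + \<sigma>) * L * sqrt t)"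
    using pos by (intro add_mono mult_left_mono Q' half) auto
  also have "\<dots> = rate_const G \<gamma> \<eta> D \<Delta> * ((1 + \<sigma>) * L * sqrt t)"
    unfolding rate_const_def Let_def a_def[symmetric] p0_def[symmetric]
    by (simp only: ring_distribs mult_ac add_ac)
  finally have "(Q + D\<^sup>2 / (2 * \<eta>) * (\<gamma> + (\<Delta> + Q) / (2 * \<eta>))) / t
      \<le> rate_const G \<gamma> \<eta> D \<Delta> * ((1 + \<sigma>) * L * sqrt t) / t"
    by (intro divide_right_mono) auto
  also have "\<dots> = rate_const G \<gamma> \<eta> D \<Delta> * ((1 + \<sigma>) * L) * (sqrt t / t)" by simp
  also have "\<dots> = rate_const G \<gamma> \<eta> D \<Delta> * rate \<sigma> t"
    unfolding sqrt_divide_self_eq[OF of_nat_0_le_iff]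
    by (simp add: rate_def L_def m_def divide_inverse)
  finally show ?thesis .
qed

lemma rate_const_pos:
  assumes "G \<ge> 0" "\<gamma> > 0" "\<eta> > 0" "D > 0" "\<Delta> \<ge> 0"
  shows "0 < rate_const G \<gamma> \<eta> D \<Delta>"
proof -
  define a where "a = 1 + (\<Delta> + 2 * D * (2 * G + 1)) / (2 * \<eta> * \<gamma>)"
  have "a \<ge> 1" using assms by (simp add: a_def)
  then have "0 \<le> log 2 a" by simp
  then have "0 \<le> (3 * G + 2) * sqrt (2 * (\<eta>\<^sup>2 + D\<^sup>2) * (1 + log 2 a)) * (1 + D\<^sup>2 / (4 * \<eta>\<^sup>2))"
    using assms by simp
  moreover have "0 < D\<^sup>2 / \<eta> * (\<gamma> + \<Delta> / (2 * \<eta>))"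
    using assms by (intro mult_pos_pos divide_pos_pos add_pos_nonneg) auto
  ultimately show ?thesis
    unfolding rate_const_def Let_def a_def[symmetric] by linarith
qed

section \<open>The filtration of the samples and adaptedness of the iterates\<close>

lemma subalgebra_history:
  assumes "\<And>i. i \<ge> 1 \<Longrightarrow> \<xi> i \<in> measurable M P"
  shows "subalgebra M (history M P \<xi> k)"
  unfolding subalgebra_def history_def
proof (intro conjI sets_image_in_sets)
  show "(\<lambda>\<omega>. \<lambda>i\<in>{1..<k}. \<xi> i \<omega>) \<in> measurable M (\<Pi>\<^sub>M i\<in>{1..<k}. P)"
    by (rule measurable_restrict) (use assms in auto)
qed auto

text \<open>Each earlier sample is a coordinate of the longer tuple, so the shorter tuple is
  measurable for the later sigma-algebra.\<close>

lemma subalgebra_history_mono: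
  assumes "\<And>i. i \<ge> 1 \<Longrightarrow> \<xi> i \<in> measurable M P" and "j \<le> k"
  shows "subalgebra (history M P \<xi> k) (history M P \<xi> j)"
proof -
  have "(\<lambda>\<omega>. \<lambda>i\<in>{1..<k}. \<xi> i \<omega>) \<in> space M \<rightarrow> space (\<Pi>\<^sub>M i\<in>{1..<k}. P)"
    using assms(1) by (auto simp: space_PiM intro!: measurable_space[OF assms(1)])
  then have tup: "(\<lambda>\<omega>. \<lambda>i\<in>{1..<k}. \<xi> i \<omega>) \<in> measurable (history M P \<xi> k) (\<Pi>\<^sub>M i\<in>{1..<k}. P)"
    unfolding history_def by (rule measurable_vimage_algebra1)
  have \<xi>: "\<xi> i \<in> measurable (history M P \<xi> k) P" if "i \<in> {1..<j}" for i
  proof -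
    have i: "i \<in> {1..<k}" using that assms(2) by auto
    have "(\<lambda>\<omega>. (\<lambda>i\<in>{1..<k}. \<xi> i \<omega>) i) \<in> measurable (history M P \<xi> k) P"
      by (rule measurable_compose[OF tup measurable_component_singleton[OF i]])
    then show ?thesis using i by simp
  qed
  show ?thesis
    unfolding subalgebra_def
  proof
    show "space (history M P \<xi> j) = space (history M P \<xi> k)" by (simp add: history_def)
    show "sets (history M P \<xi> j) \<subseteq> sets (history M P \<xi> k)"
      unfolding history_def[of M P \<xi> j]
    proof (rule sets_image_in_sets)
      show "space (history M P \<xi> k) = space M" by (simp add: history_def)
      show "(\<lambda>\<omega>. \<lambda>i\<in>{1..<j}. \<xi> i \<omega>) \<in> measurable (history M P \<xi> k) (\<Pi>\<^sub>M i\<in>{1..<j}. P)"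
        by (rule measurable_restrict) (rule \<xi>)
    qed
  qed
qed

text \<open>Predictability: iterate and scaling at time \<open>k\<close> use only samples before
  \<open>k\<close>, which later lets \<open>x k\<close> be pulled out of the conditional
  expectation. The induction is joint since \<open>x (k + 1)\<close> depends on \<open>S k\<close>
  and \<open>S (k + 1)\<close> on \<open>x (k + 1)\<close>.\<close>

lemma iterates_measurable_history:
  fixes h :: "'a::euclidean_space \<Rightarrow> ereal"
  assumes \<xi>: "\<And>i. i \<ge> 1 \<Longrightarrow> \<xi> i \<in> measurable M P"
    and h: "convex_fun h" "proper_fun h" and "\<eta> > 0" "\<gamma> > 0"
    and x_init: "\<And>\<omega>. \<omega> \<in> space M \<Longrightarrow> x 1 \<omega> = x1"
    and S_init: "\<And>\<omega>. \<omega> \<in> space M \<Longrightarrow> S 1 \<omega> = \<gamma>"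
    and g: "\<And>k. k \<ge> 1 \<Longrightarrow> g k \<in> borel_measurable (history M P \<xi> (k + 1))"
    and x_step: "\<And>k \<omega>. k \<ge> 1 \<Longrightarrow> \<omega> \<in> space M \<Longrightarrow>
      is_arg_min (prox_objective h \<eta> (g k \<omega>) (S k \<omega>) (x k \<omega>)) (\<lambda>_. True) (x (k + 1) \<omega>)"
    and S_step: "\<And>k \<omega>. k \<ge> 1 \<Longrightarrow> \<omega> \<in> space M \<Longrightarrow>
      (S (k + 1) \<omega>)\<^sup>2 = (S k \<omega>)\<^sup>2 * (1 + (norm (x (k + 1) \<omega> - x k \<omega>))\<^sup>2 / \<eta>\<^sup>2) \<and> S (k + 1) \<omega> > 0"
    and "k \<ge> 1"
  shows "x k \<in> borel_measurable (history M P \<xi> k) \<and> S k \<in> borel_measurable (history M P \<xi> k)"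
  using \<open>k \<ge> 1\<close>
proof (induction k rule: nat_induct_at_least)
  case base
  have "x 1 \<in> borel_measurable (history M P \<xi> 1) \<longleftrightarrow> (\<lambda>_. x1) \<in> borel_measurable (history M P \<xi> 1)"
    by (intro measurable_cong) (simp add: history_def x_init[simplified])
  moreover have "S 1 \<in> borel_measurable (history M P \<xi> 1)
      \<longleftrightarrow> (\<lambda>_. \<gamma>) \<in> borel_measurable (history M P \<xi> 1)"
    by (intro measurable_cong) (simp add: history_def S_init[simplified])
  ultimately show ?case by simp
next
  case (Suc k)
  \<comment> \<open>With this index the history includes \<open>\<xi> k\<close>, the newest sample
    that \<open>g k\<close> may use.\<close>
  define N where "N = history M P \<xi> (k + 1)"
  have spN: "space N = space M" by (simp add: N_def history_def)
  have "subalgebra N (history M P \<xi> k)"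
    unfolding N_def by (rule subalgebra_history_mono[OF \<xi>]) auto
  then have [measurable]: "x k \<in> borel_measurable N" "S k \<in> borel_measurable N"
    using Suc.IH by (auto intro: measurable_from_subalg)
  have [measurable]: "g k \<in> borel_measurable N"
    unfolding N_def by (rule g[OF Suc.hyps])
  have Spos: "S k \<omega> > 0" if "\<omega> \<in> space M" for \<omega>
    using S_init[OF that] S_step[of "k - 1" \<omega>] that \<open>\<gamma> > 0\<close> Suc.hyps
    by (cases "k = 1") auto
  have x': "x (k + 1) \<in> borel_measurable N"
    by (rule borel_measurable_prox[OF h \<open>\<eta> > 0\<close> \<open>g k \<in> _\<close> \<open>S k \<in> _\<close> \<open>x k \<in> _\<close>])
      (use Spos x_step Suc.hyps in \<open>auto simp: spN\<close>)
  note [measurable] = this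
  \<comment> \<open>Positivity singles out the nonnegative root, which makes the scaling an explicit
    measurable expression.\<close>
  have "S (k + 1) \<omega> = sqrt ((S k \<omega>)\<^sup>2 * (1 + (norm (x (k + 1) \<omega> - x k \<omega>))\<^sup>2 / \<eta>\<^sup>2))"
    if "\<omega> \<in> space N" for \<omega>
    using S_step[of k \<omega>] Suc.hyps that spN by (metis abs_of_pos real_sqrt_abs)
  moreover have "(\<lambda>\<omega>. sqrt ((S k \<omega>)\<^sup>2 * (1 + (norm (x (k + 1) \<omega> - x k \<omega>))\<^sup>2 / \<eta>\<^sup>2)))
      \<in> borel_measurable N"
    by measurable
  ultimately have "S (k + 1) \<in> borel_measurable N"
    by (subst measurable_cong) auto
  with x' show ?case by (simp add: N_def)
qed

section \<open>Conditional expectations and moments of the noise\<close>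

text \<open>Orthogonality of the noise to the past: in each coordinate the factor measurable for
  \<open>F\<close> is pulled out of the conditional expectation. Boundedness of \<open>X\<close>
  makes the products integrable.\<close>

lemma (in sigma_finite_subalgebra) integral_inner_vec_cond_exp_diff:
  fixes X Y V :: "'a \<Rightarrow> 'b::euclidean_space"
  assumes Y: "integrable M Y" and X: "X \<in> borel_measurable F"
    and bound: "AE \<omega> in M. norm (X \<omega>) \<le> D"
    and V: "AE \<omega> in M. vec_cond_exp M F Y \<omega> = V \<omega>" "integrable M V"
  shows "integrable M (\<lambda>\<omega>. (Y \<omega> - V \<omega>) \<bullet> X \<omega>)" "(\<integral>\<omega>. (Y \<omega> - V \<omega>) \<bullet> X \<omega> \<partial>M) = 0"
proof -
  have XM [measurable]: "X \<in> borel_measurable M"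
    by (rule measurable_from_subalg[OF subalg X])
  have XF: "(\<lambda>\<omega>. X \<omega> \<bullet> b) \<in> borel_measurable F" for b
    using X by measurable
  have [measurable]: "Y \<in> borel_measurable M" "V \<in> borel_measurable M" using Y V by auto
  have int: "integrable M (\<lambda>\<omega>. (X \<omega> \<bullet> b) * (Z \<omega> \<bullet> b))"
    if "b \<in> Basis" "integrable M Z" for Z :: "'a \<Rightarrow> 'b" and b
  proof (rule Bochner_Integration.integrable_bound)
    have [measurable]: "Z \<in> borel_measurable M" using that(2) by auto
    show "(\<lambda>\<omega>. (X \<omega> \<bullet> b) * (Z \<omega> \<bullet> b)) \<in> borel_measurable M" by measurable
    show "integrable M (\<lambda>\<omega>. D * norm (Z \<omega>))" using that by simp
    show "AE \<omega> in M. norm ((X \<omega> \<bullet> b) * (Z \<omega> \<bullet> b)) \<le> norm (D * norm (Z \<omega>))"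
      using bound
    proof eventually_elim
      case (elim \<omega>)
      have "\<bar>X \<omega> \<bullet> b\<bar> * \<bar>Z \<omega> \<bullet> b\<bar> \<le> D * norm (Z \<omega>)"
        using elim Basis_le_norm[OF that(1), of "X \<omega>"] Basis_le_norm[OF that(1), of "Z \<omega>"]
        by (intro mult_mono) auto
      then show ?case by (simp add: abs_mult) (smt (verit) mult_right_mono norm_ge_zero)
    qed
  qed
  have eq: "(\<integral>\<omega>. (X \<omega> \<bullet> b) * (V \<omega> \<bullet> b) \<partial>M) = (\<integral>\<omega>. (X \<omega> \<bullet> b) * (Y \<omega> \<bullet> b) \<partial>M)"
    if b: "b \<in> Basis" for b
  proof -
    have "(\<integral>\<omega>. (X \<omega> \<bullet> b) * real_cond_exp M F (\<lambda>\<omega>. Y \<omega> \<bullet> b) \<omega> \<partial>M)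
        = (\<integral>\<omega>. (X \<omega> \<bullet> b) * (Y \<omega> \<bullet> b) \<partial>M)"
      by (rule real_cond_exp_intg(2)[OF int[OF b Y] XF]) measurable
    moreover have "(\<integral>\<omega>. (X \<omega> \<bullet> b) * (V \<omega> \<bullet> b) \<partial>M)
        = (\<integral>\<omega>. (X \<omega> \<bullet> b) * real_cond_exp M F (\<lambda>\<omega>. Y \<omega> \<bullet> b) \<omega> \<partial>M)"
    proof (rule integral_cong_AE)
      show "(\<lambda>\<omega>. X \<omega> \<bullet> b * (V \<omega> \<bullet> b)) \<in> borel_measurable M" by measurable
      show "(\<lambda>\<omega>. X \<omega> \<bullet> b * real_cond_exp M F (\<lambda>\<omega>. Y \<omega> \<bullet> b) \<omega>) \<in> borel_measurable M"
        by measurable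
      show "AE \<omega> in M. X \<omega> \<bullet> b * (V \<omega> \<bullet> b)
          = X \<omega> \<bullet> b * real_cond_exp M F (\<lambda>\<omega>. Y \<omega> \<bullet> b) \<omega>"
        using V(1)
      proof eventually_elim
        case (elim \<omega>)
        then have "V \<omega> \<bullet> b = (\<Sum>c\<in>Basis. real_cond_exp M F (\<lambda>\<omega>. Y \<omega> \<bullet> c) \<omega> *\<^sub>R c) \<bullet> b"
          by (simp add: vec_cond_exp_def)
        then show ?case using b by simp
      qed
    qed
    ultimately show ?thesis by simp
  qed
  have sum: "(Y \<omega> - V \<omega>) \<bullet> X \<omega>
      = (\<Sum>b\<in>Basis. (X \<omega> \<bullet> b) * (Y \<omega> \<bullet> b) - (X \<omega> \<bullet> b) * (V \<omega> \<bullet> b))" for \<omega>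
    by (subst euclidean_inner) (simp add: inner_diff_left algebra_simps)
  show "integrable M (\<lambda>\<omega>. (Y \<omega> - V \<omega>) \<bullet> X \<omega>)"
    unfolding sum using int Y V(2) by (intro Bochner_Integration.integrable_sum) simp
  show "(\<integral>\<omega>. (Y \<omega> - V \<omega>) \<bullet> X \<omega> \<partial>M) = 0"
    unfolding sum using int Y V(2) eq
    by (subst Bochner_Integration.integral_sum) (auto simp: Bochner_Integration.integral_diff)
qed

text \<open>Integrating the nonnegative conditional expectation gives the second moment, and its
  finiteness yields integrability. The first moment follows from
  \<open>n \<le> (n\<^sup>2 / \<sigma> + \<sigma>) / 2\<close>, whose expectation is at most
  \<sigma>.\<close>

lemma second_moment_le_of_nn_cond_exp:
  fixes n :: "'w \<Rightarrow> real"
  assumes "prob_space M" "subalgebra M F" and n [measurable]: "n \<in> borel_measurable M"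
    and "\<sigma> > 0" "\<And>\<omega>. n \<omega> \<ge> 0"
    and var: "AE \<omega> in M. nn_cond_exp M F (\<lambda>\<omega>. ennreal ((n \<omega>)\<^sup>2)) \<omega> \<le> ennreal (\<sigma>\<^sup>2)"
  shows "integrable M (\<lambda>\<omega>. (n \<omega>)\<^sup>2)" "(\<integral>\<omega>. (n \<omega>)\<^sup>2 \<partial>M) \<le> \<sigma>\<^sup>2"
    "integrable M n" "(\<integral>\<omega>. n \<omega> \<partial>M) \<le> \<sigma>"
proof -
  interpret prob_space M by fact
  interpret finite_measure_subalgebra M F
    by unfold_locales (rule assms(2))
  have "(\<integral>\<^sup>+\<omega>. ennreal ((n \<omega>)\<^sup>2) \<partial>M) = (\<integral>\<^sup>+\<omega>. nn_cond_exp M F (\<lambda>\<omega>. ennreal ((n \<omega>)\<^sup>2)) \<omega> \<partial>M)"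
    using nn_cond_exp_intg[of "\<lambda>_. 1" "\<lambda>\<omega>. ennreal ((n \<omega>)\<^sup>2)"] by simp
  also have "\<dots> \<le> (\<integral>\<^sup>+\<omega>. ennreal (\<sigma>\<^sup>2) \<partial>M)"
    by (rule nn_integral_mono_AE) (rule var)
  also have "\<dots> = ennreal (\<sigma>\<^sup>2)" by (simp add: emeasure_space_1)
  finally have le: "(\<integral>\<^sup>+\<omega>. ennreal ((n \<omega>)\<^sup>2) \<partial>M) \<le> ennreal (\<sigma>\<^sup>2)" .
  show n2: "integrable M (\<lambda>\<omega>. (n \<omega>)\<^sup>2)"
    by (rule integrableI_nonneg) (use le in \<open>auto intro: le_less_trans\<close>)
  have "ennreal (\<integral>\<omega>. (n \<omega>)\<^sup>2 \<partial>M) \<le> ennreal (\<sigma>\<^sup>2)"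
    using le n2 by (simp add: nn_integral_eq_integral)
  then show le': "(\<integral>\<omega>. (n \<omega>)\<^sup>2 \<partial>M) \<le> \<sigma>\<^sup>2" by simp
  have am: "n \<omega> \<le> ((n \<omega>)\<^sup>2 / \<sigma> + \<sigma>) / 2" for \<omega>
    using zero_le_power2[of "n \<omega> - \<sigma>"] assms(4)
    by (simp add: field_simps power2_eq_square)
  have int: "integrable M (\<lambda>\<omega>. ((n \<omega>)\<^sup>2 / \<sigma> + \<sigma>) / 2)" using n2 by simp
  have "norm (n \<omega>) \<le> norm (((n \<omega>)\<^sup>2 / \<sigma> + \<sigma>) / 2)" for \<omega>
    using am[of \<omega>] assms(5)[of \<omega>] unfolding real_norm_def by linarith
  then show n1: "integrable M n"
    by (intro Bochner_Integration.integrable_bound[OF int]) auto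
  have "(\<integral>\<omega>. n \<omega> \<partial>M) \<le> (\<integral>\<omega>. ((n \<omega>)\<^sup>2 / \<sigma> + \<sigma>) / 2 \<partial>M)"
    by (rule integral_mono[OF n1 int]) (rule am)
  also have "\<dots> = ((\<integral>\<omega>. (n \<omega>)\<^sup>2 \<partial>M) / \<sigma> + \<sigma>) / 2"
    using n2 by (simp add: prob_space)
  also have "\<dots> \<le> (\<sigma>\<^sup>2 / \<sigma> + \<sigma>) / 2"
    using le' assms(4) by (intro divide_right_mono add_right_mono) auto
  also have "\<dots> = \<sigma>" by (simp add: power2_eq_square)
  finally show "(\<integral>\<omega>. n \<omega> \<partial>M) \<le> \<sigma>" .
qed

text \<open>The product is estimated twice: by \<open>d \<le> D\<close>, for the crude linear bound,
  and by the weighted arithmetic-geometric inequality, for the sharp one. Both moments of the noise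
  recombine into \<open>(2 * G + \<sigma>)\<^sup>2\<close>.\<close>

lemma noise_displacement_expectation:
  fixes n d :: "'w \<Rightarrow> real"
  assumes "prob_space M" "G \<ge> 0" "\<sigma> > 0"
    and n: "\<And>\<omega>. n \<omega> \<ge> 0" "integrable M n" "(\<integral>\<omega>. n \<omega> \<partial>M) \<le> \<sigma>"
      "integrable M (\<lambda>\<omega>. (n \<omega>)\<^sup>2)" "(\<integral>\<omega>. (n \<omega>)\<^sup>2 \<partial>M) \<le> \<sigma>\<^sup>2"
    and d: "d \<in> borel_measurable M" "\<And>\<omega>. d \<omega> \<ge> 0" "AE \<omega> in M. d \<omega> \<le> D" "D > 0"
  shows "integrable M (\<lambda>\<omega>. (d \<omega>)\<^sup>2)" "integrable M (\<lambda>\<omega>. (2 * G + n \<omega>) * d \<omega>)"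
    "(\<integral>\<omega>. (2 * G + n \<omega>) * d \<omega> \<partial>M) \<le> D * (2 * G + \<sigma>)"
    "\<epsilon> > 0 \<Longrightarrow> (\<integral>\<omega>. (2 * G + n \<omega>) * d \<omega> \<partial>M)
      \<le> (\<epsilon> * (2 * G + \<sigma>)\<^sup>2 + (\<integral>\<omega>. (d \<omega>)\<^sup>2 \<partial>M) / \<epsilon>) / 2"
proof -
  interpret prob_space M by fact
  have [measurable]: "n \<in> borel_measurable M" "d \<in> borel_measurable M" using n d by auto
  show d2: "integrable M (\<lambda>\<omega>. (d \<omega>)\<^sup>2)"
  proof (rule integrable_const_bound)
    show "AE \<omega> in M. norm ((d \<omega>)\<^sup>2) \<le> D\<^sup>2"
      using d(3) by eventually_elim (use d(2) in \<open>auto intro: power_mono\<close>)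
  qed measurable
  have intD: "integrable M (\<lambda>\<omega>. D * (2 * G + n \<omega>))" using n by simp
  have W: "AE \<omega> in M. (2 * G + n \<omega>) * d \<omega> \<le> D * (2 * G + n \<omega>)"
    using d(3)
  proof eventually_elim
    case (elim \<omega>)
    then show ?case
      using mult_left_mono[of "d \<omega>" D "2 * G + n \<omega>"] n(1)[of \<omega>] assms(2) by (simp add: mult.commute)
  qed
  show int: "integrable M (\<lambda>\<omega>. (2 * G + n \<omega>) * d \<omega>)"
  proof (rule Bochner_Integration.integrable_bound[OF intD])
    show "AE \<omega> in M. norm ((2 * G + n \<omega>) * d \<omega>) \<le> norm (D * (2 * G + n \<omega>))"
      using W by eventually_elim (use n(1) d(2,4) assms(2) in \<open>auto simp: abs_mult\<close>)
  qed measurable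
  have "(\<integral>\<omega>. (2 * G + n \<omega>) * d \<omega> \<partial>M) \<le> (\<integral>\<omega>. D * (2 * G + n \<omega>) \<partial>M)"
    by (rule integral_mono_AE[OF int intD W])
  also have "\<dots> = D * (2 * G + (\<integral>\<omega>. n \<omega> \<partial>M))" using n by (simp add: prob_space)
  also have "\<dots> \<le> D * (2 * G + \<sigma>)" using n d by simp
  finally show "(\<integral>\<omega>. (2 * G + n \<omega>) * d \<omega> \<partial>M) \<le> D * (2 * G + \<sigma>)" .
  show "(\<integral>\<omega>. (2 * G + n \<omega>) * d \<omega> \<partial>M)
      \<le> (\<epsilon> * (2 * G + \<sigma>)\<^sup>2 + (\<integral>\<omega>. (d \<omega>)\<^sup>2 \<partial>M) / \<epsilon>) / 2" if "\<epsilon> > 0"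
  proof -
    have am: "(2 * G + n \<omega>) * d \<omega>
        \<le> (\<epsilon> * (4 * G\<^sup>2 + 4 * G * n \<omega> + (n \<omega>)\<^sup>2) + (d \<omega>)\<^sup>2 / \<epsilon>) / 2" for \<omega>
    proof -
      have "0 \<le> (\<epsilon> * (2 * G + n \<omega>) - d \<omega>)\<^sup>2 / \<epsilon>" using that by simp
      then show ?thesis using that by (simp add: power2_eq_square field_simps)
    qed
    have "(\<integral>\<omega>. (2 * G + n \<omega>) * d \<omega> \<partial>M)
        \<le> (\<integral>\<omega>. (\<epsilon> * (4 * G\<^sup>2 + 4 * G * n \<omega> + (n \<omega>)\<^sup>2) + (d \<omega>)\<^sup>2 / \<epsilon>) / 2 \<partial>M)"
      by (rule integral_mono[OF int _ am]) (use n d2 in simp)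
    also have "\<dots> = (\<epsilon> * (4 * G\<^sup>2 + 4 * G * (\<integral>\<omega>. n \<omega> \<partial>M) + (\<integral>\<omega>. (n \<omega>)\<^sup>2 \<partial>M))
        + (\<integral>\<omega>. (d \<omega>)\<^sup>2 \<partial>M) / \<epsilon>) / 2"
      using n d2 by (simp add: prob_space)
    also have "\<dots> \<le> (\<epsilon> * (4 * G\<^sup>2 + 4 * G * \<sigma> + \<sigma>\<^sup>2) + (\<integral>\<omega>. (d \<omega>)\<^sup>2 \<partial>M) / \<epsilon>) / 2"
      using n assms(2) that
      by (intro divide_right_mono add_right_mono mult_left_mono add_mono) auto
    finally show ?thesis by (simp add: power2_eq_square algebra_simps)
  qed
qed

section \<open>The expected gap of the averaged iterate\<close>

theorem theorem3:
  fixes f :: "'a::euclidean_space \<Rightarrow> real" and h :: "'a \<Rightarrow> ereal" and F :: "'a \<Rightarrow> ereal"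
    and l :: "'a \<Rightarrow> 's \<Rightarrow> real" and P :: "'s measure"
    and M :: "'w measure" and \<xi> :: "nat \<Rightarrow> 'w \<Rightarrow> 's"
    and grad_l :: "'a \<Rightarrow> 's \<Rightarrow> 'a" and grad_f :: "'a \<Rightarrow> 'a"
    and x :: "nat \<Rightarrow> 'w \<Rightarrow> 'a" and g :: "nat \<Rightarrow> 'w \<Rightarrow> 'a" and S :: "nat \<Rightarrow> 'w \<Rightarrow> real"
    and x1 xstar :: 'a and G \<gamma> \<eta> D \<sigma> :: real
  assumes prob: "prob_space M"
    and samples_indep: "prob_space.indep_vars M (\<lambda>_. P) \<xi> {1..}"
    and samples_distr: "\<And>k. k \<ge> 1 \<Longrightarrow> distr M P (\<xi> k) = P"
    and l_integrable: "\<And>z. integrable P (l z)"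
    and f_def: "\<And>z. f z = (\<integral>s. l z s \<partial>P)"
    and f_convex: "convex_on UNIV f"
    and f_lipschitz: "G-lipschitz_on UNIV f"
    and h_convex: "convex_fun h" and h_proper: "proper_fun h" and h_lsc: "lower_semicont h"
    and F_def: "\<And>z. F z = ereal (f z) + h z"
    and F_min: "\<And>z. F xstar \<le> F z"
    and pos: "\<gamma> > 0" "\<eta> > 0" "D > 0" "\<sigma> > 0"
    and x1_dom: "x1 \<in> effective_domain h"
    and x_init: "\<And>\<omega>. \<omega> \<in> space M \<Longrightarrow> x 1 \<omega> = x1"
    and S_init: "\<And>\<omega>. \<omega> \<in> space M \<Longrightarrow> S 1 \<omega> = \<gamma>"
    and g_def: "\<And>k \<omega>. k \<ge> 1 \<Longrightarrow> \<omega> \<in> space M \<Longrightarrow> g k \<omega> = grad_l (x k \<omega>) (\<xi> k \<omega>)"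
    and g_grad: "\<And>k \<omega>. k \<ge> 1 \<Longrightarrow> \<omega> \<in> space M \<Longrightarrow>
      grad_or_subgrad (\<lambda>z. l z (\<xi> k \<omega>)) (x k \<omega>) (g k \<omega>)"
    and g_measurable: "\<And>k. k \<ge> 1 \<Longrightarrow> g k \<in> borel_measurable (history M P \<xi> (k + 1))"
    and x_step: "\<And>k \<omega>. k \<ge> 1 \<Longrightarrow> \<omega> \<in> space M \<Longrightarrow>
      is_arg_min (prox_objective h \<eta> (g k \<omega>) (S k \<omega>) (x k \<omega>)) (\<lambda>_. True) (x (k + 1) \<omega>)"
    and S_step: "\<And>k \<omega>. k \<ge> 1 \<Longrightarrow> \<omega> \<in> space M \<Longrightarrow>
      (S (k + 1) \<omega>)\<^sup>2 = (S k \<omega>)\<^sup>2 * (1 + (norm (x (k + 1) \<omega> - x k \<omega>))\<^sup>2 / \<eta>\<^sup>2) \<and> S (k + 1) \<omega> > 0"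
    and bounded_iterates: "\<And>k. k \<ge> 1 \<Longrightarrow> AE \<omega> in M.
      norm (x (k + 1) \<omega> - x k \<omega>) \<le> D \<and> norm (x k \<omega> - xstar) \<le> D"
    and grad_f_measurable: "\<And>k. k \<ge> 1 \<Longrightarrow> (\<lambda>\<omega>. grad_f (x k \<omega>)) \<in> borel_measurable M"
    and unbiased: "\<And>k. k \<ge> 1 \<Longrightarrow> AE \<omega> in M.
      vec_cond_exp M (history M P \<xi> k) (g k) \<omega> = grad_f (x k \<omega>)
      \<and> grad_f (x k \<omega>) \<in> subdifferential f (x k \<omega>)"
    and bounded_variance: "\<And>k. k \<ge> 1 \<Longrightarrow> AE \<omega> in M.
      nn_cond_exp M (history M P \<xi> k) (\<lambda>\<omega>'. ennreal ((norm (g k \<omega>' - grad_f (x k \<omega>')))\<^sup>2)) \<omega>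
      \<le> ennreal (\<sigma>\<^sup>2)"
  shows "0 < rate_const G \<gamma> \<eta> D (real_of_ereal (F x1 - F xstar)) \<and>
    (\<forall>t\<ge>1. (\<integral>\<^sup>+ \<omega>. e2ennreal (F (running_mean (\<lambda>k. x k \<omega>) t) - F xstar) \<partial>M)
       \<le> ennreal (rate_const G \<gamma> \<eta> D (real_of_ereal (F x1 - F xstar)) * rate \<sigma> t))"
proof -
  interpret prob_space M by (rule prob)
  note h = h_convex h_proper
  have \<xi>: "\<xi> i \<in> measurable M P" if "i \<ge> 1" for i
    using samples_indep that by (auto simp: indep_vars_def2)
  note sub = subalgebra_history[where \<xi> = \<xi> and P = P, OF \<xi>]
  have x_hist: "x k \<in> borel_measurable (history M P \<xi> k)" if "k \<ge> 1" for k
    by (rule conjunct1[OF iterates_measurable_history[where P = P and \<xi> = \<xi> and x = x and S = S and g = g,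
          OF \<xi> h pos(2,1) x_init S_init g_measurable x_step S_step that]])
  have x_meas: "x k \<in> borel_measurable M" if "k \<ge> 1" for k
    by (rule measurable_from_subalg[OF sub x_hist[OF that]])
  have g_meas: "g k \<in> borel_measurable M" if "k \<ge> 1" for k
    by (rule measurable_from_subalg[OF sub g_measurable[OF that]])
  have G: "G \<ge> 0" by (rule lipschitz_on_nonneg[OF f_lipschitz])

  \<comment> \<open>A real-valued version of \<open>F\<close>, faithful on the effective domain; all
    iterates and the minimizer lie there.\<close>
  define \<Phi> where "\<Phi> = (\<lambda>z. f z + real_of_ereal (h z))"
  have \<Phi>: "\<Phi> y = f y + real_of_ereal (h y)" for y by (simp add: \<Phi>_def)
  have F_\<Phi>: "F z = ereal (\<Phi> z)" if "z \<in> effective_domain h" for z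
    using ereal_real_on_domain[OF h_proper that] by (metis F_def \<Phi> plus_ereal.simps(1))
  have "F xstar < \<infinity>"
    using F_min[of x1] F_\<Phi>[OF x1_dom] by auto
  then have xs_dom: "xstar \<in> effective_domain h"
    by (auto simp: F_def effective_domain_def less_top)
  have \<Phi>_min: "\<Phi> xstar \<le> \<Phi> y" if "y \<in> effective_domain h" for y
    using F_min[of y] F_\<Phi>[OF that] F_\<Phi>[OF xs_dom] by simp
  have "convex_on (effective_domain h) f"
    using f_convex convex_on_effective_domain[OF h] by (auto simp: convex_on_def)
  then have \<Phi>_convex: "convex_on (effective_domain h) \<Phi>"
    unfolding \<Phi>_def using convex_on_effective_domain[OF h] by (intro convex_on_add)
  define \<Delta> where "\<Delta> = \<Phi> x1 - \<Phi> xstar"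
  have \<Delta>: "real_of_ereal (F x1 - F xstar) = \<Delta>" "\<Delta> \<ge> 0"
    using F_\<Phi>[OF x1_dom] F_\<Phi>[OF xs_dom] \<Phi>_min[OF x1_dom] by (auto simp: \<Delta>_def)

  define v where "v = (\<lambda>k \<omega>. grad_f (x k \<omega>))"
  define n where "n = (\<lambda>k \<omega>. norm (g k \<omega> - v k \<omega>))"
  define d where "d = (\<lambda>k \<omega>. norm (x (k + 1) \<omega> - x k \<omega>))"
  define W where "W = (\<lambda>k \<omega>. (2 * G + n k \<omega>) * d k \<omega>)"
  define E where "E = (\<lambda>k \<omega>. (g k \<omega> - v k \<omega>) \<bullet> (x k \<omega> - xstar))"
  have v_meas: "v k \<in> borel_measurable M" if "k \<ge> 1" for k
    using grad_f_measurable[OF that] by (simp add: v_def)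
  have n_meas: "n k \<in> borel_measurable M" if "k \<ge> 1" for k
    unfolding n_def using g_meas[OF that] v_meas[OF that] by measurable
  have d_meas: "d k \<in> borel_measurable M" if "k \<ge> 1" for k
    unfolding d_def using x_meas[of k] x_meas[of "k + 1"] that by measurable
  have n_moments: "integrable M (\<lambda>\<omega>. (n k \<omega>)\<^sup>2)" "(\<integral>\<omega>. (n k \<omega>)\<^sup>2 \<partial>M) \<le> \<sigma>\<^sup>2"
    "integrable M (n k)" "(\<integral>\<omega>. n k \<omega> \<partial>M) \<le> \<sigma>" if "k \<ge> 1" for k
    using second_moment_le_of_nn_cond_exp[OF prob sub n_meas[OF that] pos(4), of k]
      bounded_variance[OF that] by (auto simp: n_def v_def)
  have W_moments: "integrable M (\<lambda>\<omega>. (d k \<omega>)\<^sup>2)" "integrable M (W k)"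
    "(\<integral>\<omega>. W k \<omega> \<partial>M) \<le> D * (2 * G + \<sigma>)"
    "\<epsilon> > 0 \<Longrightarrow> (\<integral>\<omega>. W k \<omega> \<partial>M) \<le> (\<epsilon> * (2 * G + \<sigma>)\<^sup>2 + (\<integral>\<omega>. (d k \<omega>)\<^sup>2 \<partial>M) / \<epsilon>) / 2"
    if "k \<ge> 1" for k \<epsilon>
  proof -
    have "AE \<omega> in M. d k \<omega> \<le> D"
      using bounded_iterates[OF that] by eventually_elim (simp add: d_def)
    note * = noise_displacement_expectation[OF prob G pos(4) _ n_moments(3,4,1,2)[OF that]
        d_meas[OF that] _ this pos(3)]
    show "integrable M (\<lambda>\<omega>. (d k \<omega>)\<^sup>2)" by (rule *(1)) (auto simp: n_def d_def)
    show "integrable M (W k)" unfolding W_def by (rule *(2)) (auto simp: n_def d_def)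
    show "(\<integral>\<omega>. W k \<omega> \<partial>M) \<le> D * (2 * G + \<sigma>)"
      unfolding W_def by (rule *(3)) (auto simp: n_def d_def)
    show "(\<integral>\<omega>. W k \<omega> \<partial>M) \<le> (\<epsilon> * (2 * G + \<sigma>)\<^sup>2 + (\<integral>\<omega>. (d k \<omega>)\<^sup>2 \<partial>M) / \<epsilon>) / 2" if "\<epsilon> > 0"
      unfolding W_def by (rule *(4)) (use that in \<open>auto simp: n_def d_def\<close>)
  qed
  have E_moments: "integrable M (E k)" "(\<integral>\<omega>. E k \<omega> \<partial>M) = 0" if "k \<ge> 1" for k
  proof -
    interpret finite_measure_subalgebra M "history M P \<xi> k"
      by unfold_locales (rule sub)
    \<comment> \<open>Subgradients of a Lipschitz function are bounded by \<open>G\<close>; adding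
      the integrable noise gives integrability of \<open>g k\<close>.\<close>
    have v_int: "integrable M (v k)"
    proof (rule integrable_const_bound)
      show "AE \<omega> in M. norm (v k \<omega>) \<le> G"
        using unbiased[OF that]
        by eventually_elim (use norm_subdifferential_le[OF f_lipschitz] in \<open>auto simp: v_def\<close>)
    qed (rule v_meas[OF that])
    have "(\<lambda>\<omega>. g k \<omega> - v k \<omega>) \<in> borel_measurable M"
      using g_meas[OF that] v_meas[OF that] by measurable
    then have "integrable M (\<lambda>\<omega>. g k \<omega> - v k \<omega>)"
      using n_moments(3)[OF that] integrable_norm_iff by (auto simp: n_def)
    then have "integrable M (\<lambda>\<omega>. (g k \<omega> - v k \<omega>) + v k \<omega>)"
      using v_int by (rule Bochner_Integration.integrable_add)
    then have g_int: "integrable M (g k)" by simp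
    have X: "(\<lambda>\<omega>. x k \<omega> - xstar) \<in> borel_measurable (history M P \<xi> k)"
      using x_hist[OF that] by measurable
    have "AE \<omega> in M. norm (x k \<omega> - xstar) \<le> D"
      using bounded_iterates[OF that] by eventually_elim simp
    moreover have "AE \<omega> in M. vec_cond_exp M (history M P \<xi> k) (g k) \<omega> = v k \<omega>"
      using unbiased[OF that] by eventually_elim (simp add: v_def)
    ultimately show "integrable M (E k)" "(\<integral>\<omega>. E k \<omega> \<partial>M) = 0"
      unfolding E_def by (rule integral_inner_vec_cond_exp_diff[OF g_int X _ _ v_int])+
  qed

  \<comment> \<open>The countably many exceptional null sets are merged, so that the deterministic
    estimates apply to almost every whole path.\<close>
  have good: "AE \<omega> in M. \<forall>k\<ge>1. d k \<omega> \<le> D \<and> norm (x k \<omega> - xstar) \<le> D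
      \<and> v k \<omega> \<in> subdifferential f (x k \<omega>)"
    unfolding AE_all_countable
  proof
    fix k :: nat
    show "AE \<omega> in M. 1 \<le> k \<longrightarrow> d k \<omega> \<le> D \<and> norm (x k \<omega> - xstar) \<le> D
      \<and> v k \<omega> \<in> subdifferential f (x k \<omega>)"
    proof (cases "1 \<le> k")
      case True
      show ?thesis using bounded_iterates[OF True] unbiased[OF True]
        by eventually_elim (simp add: d_def v_def)
    qed auto
  qed

  have rate: "(\<integral>\<^sup>+ \<omega>. e2ennreal (F (running_mean (\<lambda>k. x k \<omega>) t) - F xstar) \<partial>M)
      \<le> ennreal (rate_const G \<gamma> \<eta> D \<Delta> * rate \<sigma> t)" if t: "t \<ge> 1" for t
  proof -
    \<comment> \<open>The bound on the mean gap with the scaling eliminated. It is affine in the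
      sums of \<open>W\<close> and \<open>E\<close>, so its expectation is known once
      \<open>Q\<close> is.\<close>
    define R where "R = (\<lambda>\<omega>. ((\<Sum>k=1..t. W k \<omega>) - (\<Sum>k=1..t. E k \<omega>)
      + D\<^sup>2 / (2 * \<eta>) * (\<gamma> + (\<Delta> + (\<Sum>k=1..t. W k \<omega>)) / (2 * \<eta>))) / t)"
    define Q where "Q = (\<integral>\<omega>. (\<Sum>k=1..t. W k \<omega>) \<partial>M)"
    define V where "V = (\<integral>\<omega>. (\<Sum>k=1..t. (d k \<omega>)\<^sup>2) \<partial>M)"
    have W_int: "integrable M (\<lambda>\<omega>. \<Sum>k=1..t. W k \<omega>)"
      using W_moments(2) by (intro Bochner_Integration.integrable_sum) auto
    have E_int: "integrable M (\<lambda>\<omega>. \<Sum>k=1..t. E k \<omega>)"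
      using E_moments(1) by (intro Bochner_Integration.integrable_sum) auto
    have d_int: "integrable M (\<lambda>\<omega>. \<Sum>k=1..t. (d k \<omega>)\<^sup>2)"
      using W_moments(1) by (intro Bochner_Integration.integrable_sum) auto
    have Q_sum: "Q = (\<Sum>k=1..t. \<integral>\<omega>. W k \<omega> \<partial>M)"
      unfolding Q_def using W_moments(2) by (intro Bochner_Integration.integral_sum) auto
    have V_sum: "V = (\<Sum>k=1..t. \<integral>\<omega>. (d k \<omega>)\<^sup>2 \<partial>M)"
      unfolding V_def using W_moments(1) by (intro Bochner_Integration.integral_sum) auto
    have E_sum: "(\<integral>\<omega>. (\<Sum>k=1..t. E k \<omega>) \<partial>M) = 0"
      using E_moments by (subst Bochner_Integration.integral_sum) auto
    have R_int: "integrable M R"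
      unfolding R_def using W_int E_int by simp
    have R_eq: "(\<integral>\<omega>. R \<omega> \<partial>M) = (Q + D\<^sup>2 / (2 * \<eta>) * (\<gamma> + (\<Delta> + Q) / (2 * \<eta>))) / t"
      unfolding R_def using W_int E_int E_sum by (simp add: prob_space Q_def)

    have path: "AE \<omega> in M.
        e2ennreal (F (running_mean (\<lambda>k. x k \<omega>) t) - F xstar) \<le> ennreal (R \<omega>) \<and> 0 \<le> R \<omega> \<and>
        (\<forall>c>0. (\<Sum>k=1..t. (d k \<omega>)\<^sup>2) \<le> 2 * (\<eta>\<^sup>2 + D\<^sup>2) *
          (ln c + (\<gamma> + (\<Delta> + (\<Sum>k=1..t. W k \<omega>)) / (2 * \<eta>)) / (\<gamma> * c) - 1))"
      using good AE_space
    proof eventually_elim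
      case (elim \<omega>)
      have x1: "x 1 \<omega> = x1" and S1: "S 1 \<omega> = \<gamma>"
        using x_init S_init elim by auto
      have "x 1 \<omega> \<in> effective_domain h" "S 1 \<omega> > 0"
        using x1 S1 x1_dom pos by auto
      note p = adaptive_prox_path[where x = "\<lambda>k. x k \<omega>" and g = "\<lambda>k. g k \<omega>"
          and v = "\<lambda>k. v k \<omega>" and S = "\<lambda>k. S k \<omega>" and W = "\<lambda>k. W k \<omega>" and D = D,
          OF h f_lipschitz pos(2) \<Phi> xs_dom \<Phi>_min this x_step S_step]
      have p1: "x (k + 1) \<omega> \<in> effective_domain h" for k
        by (rule p(1)) (use elim in \<open>auto simp: d_def W_def n_def\<close>)
      have p2: "0 < S (t + 1) \<omega>"
        by (rule p(2)) (use elim in \<open>auto simp: d_def W_def n_def\<close>)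
      have p3: "S (t + 1) \<omega> \<le> \<gamma> + (\<Delta> + (\<Sum>k=1..t. W k \<omega>)) / (2 * \<eta>)"
        unfolding \<Delta>_def S1[symmetric] x1[symmetric]
        by (rule p(3)) (use elim in \<open>auto simp: d_def W_def n_def\<close>)
      have p4: "(\<Sum>k=1..t. \<Phi> (x (k + 1) \<omega>) - \<Phi> xstar)
          \<le> (\<Sum>k=1..t. W k \<omega>) - (\<Sum>k=1..t. E k \<omega>) + D\<^sup>2 / (2 * \<eta>) * S (t + 1) \<omega>"
        unfolding E_def
        by (rule p(4)) (use elim in \<open>auto simp: d_def W_def n_def\<close>)
      have p5: "(\<Sum>k=1..t. (d k \<omega>)\<^sup>2) \<le> 2 * (\<eta>\<^sup>2 + D\<^sup>2) * ln (S (t + 1) \<omega> / \<gamma>)"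
        unfolding d_def S1[symmetric]
        by (rule p(5)) (use elim in \<open>auto simp: d_def W_def n_def\<close>)
      have sum_R: "(\<Sum>k=1..t. \<Phi> (x (k + 1) \<omega>) - \<Phi> xstar) / t \<le> R \<omega>"
        unfolding R_def
      proof (rule divide_right_mono)
        have "D\<^sup>2 / (2 * \<eta>) * S (t + 1) \<omega>
            \<le> D\<^sup>2 / (2 * \<eta>) * (\<gamma> + (\<Delta> + (\<Sum>k=1..t. W k \<omega>)) / (2 * \<eta>))"
          using pos by (intro mult_left_mono p3) auto
        with p4 show "(\<Sum>k=1..t. \<Phi> (x (k + 1) \<omega>) - \<Phi> xstar)
            \<le> (\<Sum>k=1..t. W k \<omega>) - (\<Sum>k=1..t. E k \<omega>)
              + D\<^sup>2 / (2 * \<eta>) * (\<gamma> + (\<Delta> + (\<Sum>k=1..t. W k \<omega>)) / (2 * \<eta>))"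
          by linarith
      qed simp
      define y where "y = running_mean (\<lambda>k. x k \<omega>) t"
      have y: "y = (\<Sum>k\<in>{1..t}. (1 / t) *\<^sub>R x (k + 1) \<omega>)"
        by (simp add: y_def running_mean_def scaleR_sum_right)
      have "y \<in> effective_domain h"
        \<comment> \<open>The average is a convex combination with weights \<open>1 / t\<close>;
          Jensen's inequality then passes from the mean gap to the gap at the mean.\<close>
        unfolding y using t p1 convex_on_imp_convex[OF \<Phi>_convex] by (intro convex_sum) auto
      moreover have "\<Phi> y \<le> (\<Sum>k\<in>{1..t}. (1 / t) * \<Phi> (x (k + 1) \<omega>))"
        unfolding y using t p1 by (intro convex_on_sum[OF _ _ \<Phi>_convex]) auto
      moreover have "(\<Sum>k\<in>{1..t}. (1 / t) * \<Phi> (x (k + 1) \<omega>)) - \<Phi> xstar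
          = (\<Sum>k=1..t. \<Phi> (x (k + 1) \<omega>) - \<Phi> xstar) / t"
        using t by (simp add: sum_subtractf sum_divide_distrib[symmetric] diff_divide_distrib)
      ultimately have "F y - F xstar = ereal (\<Phi> y - \<Phi> xstar)" "\<Phi> y - \<Phi> xstar \<le> R \<omega>"
          "0 \<le> \<Phi> y - \<Phi> xstar"
        using sum_R F_\<Phi> xs_dom \<Phi>_min by auto
      then have "e2ennreal (F y - F xstar) \<le> ennreal (R \<omega>)" "0 \<le> R \<omega>"
        by (auto intro: ennreal_leI)
      moreover have "(\<Sum>k=1..t. (d k \<omega>)\<^sup>2) \<le> 2 * (\<eta>\<^sup>2 + D\<^sup>2) *
          (ln c + (\<gamma> + (\<Delta> + (\<Sum>k=1..t. W k \<omega>)) / (2 * \<eta>)) / (\<gamma> * c) - 1)" if "c > 0" for c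
      proof -
        \<comment> \<open>The tangent to the logarithm at \<open>c\<close> replaces it by an affine
          function of the sum of \<open>W\<close>, which can be integrated; this does the work of
          Jensen's inequality.\<close>
        have "ln (S (t + 1) \<omega> / \<gamma>) = ln c + ln (S (t + 1) \<omega> / (\<gamma> * c))"
          using p2 pos that by (simp add: ln_div ln_mult)
        also have "ln (S (t + 1) \<omega> / (\<gamma> * c)) \<le> S (t + 1) \<omega> / (\<gamma> * c) - 1"
          using p2 pos that by (intro ln_le_minus_one) auto
        also have "S (t + 1) \<omega> / (\<gamma> * c)
            \<le> (\<gamma> + (\<Delta> + (\<Sum>k=1..t. W k \<omega>)) / (2 * \<eta>)) / (\<gamma> * c)"
          using pos that by (intro divide_right_mono p3) auto
        finally have "2 * (\<eta>\<^sup>2 + D\<^sup>2) * ln (S (t + 1) \<omega> / \<gamma>) \<le> 2 * (\<eta>\<^sup>2 + D\<^sup>2) *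
          (ln c + (\<gamma> + (\<Delta> + (\<Sum>k=1..t. W k \<omega>)) / (2 * \<eta>)) / (\<gamma> * c) - 1)"
          by (intro mult_left_mono) auto
        with p5 show ?thesis by linarith
      qed
      ultimately show ?case by (simp add: y_def)
    qed

    have "(\<integral>\<^sup>+ \<omega>. e2ennreal (F (running_mean (\<lambda>k. x k \<omega>) t) - F xstar) \<partial>M)
        \<le> (\<integral>\<^sup>+ \<omega>. ennreal (R \<omega>) \<partial>M)"
      using path by (intro nn_integral_mono_AE) (auto elim: eventually_mono)
    \<comment> \<open>Nonnegativity of \<open>R\<close>, inherited from the gap below it, identifies
      the two integrals, so that the signed terms in \<open>E\<close> cancel in the mean.\<close>
    also have "\<dots> = ennreal (\<integral>\<omega>. R \<omega> \<partial>M)"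
      using path by (intro nn_integral_eq_integral R_int) (auto elim: eventually_mono)
    also have "\<dots> \<le> ennreal (rate_const G \<gamma> \<eta> D \<Delta> * rate \<sigma> t)"
      unfolding R_eq
    proof (rule ennreal_leI, rule rate_const_bound[OF G pos \<Delta>(2) t])
      have "Q \<le> (\<Sum>k=1..t. D * (2 * G + \<sigma>))"
        unfolding Q_sum using W_moments(3) by (intro sum_mono) auto
      then show "Q \<le> t * (D * (2 * G + \<sigma>))" by simp
    next
      fix \<epsilon> :: real assume "\<epsilon> > 0"
      have "Q \<le> (\<Sum>k=1..t. (\<epsilon> * (2 * G + \<sigma>)\<^sup>2 + (\<integral>\<omega>. (d k \<omega>)\<^sup>2 \<partial>M) / \<epsilon>) / 2)"
        unfolding Q_sum using W_moments(4) \<open>\<epsilon> > 0\<close> by (intro sum_mono) auto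
      also have "\<dots> = (\<epsilon> * (t * (2 * G + \<sigma>)\<^sup>2) + V / \<epsilon>) / 2"
        by (simp add: V_sum sum.distrib sum_divide_distrib[symmetric] mult_ac)
      finally show "Q \<le> (\<epsilon> * (t * (2 * G + \<sigma>)\<^sup>2) + V / \<epsilon>) / 2" .
    next
      fix c :: real assume c: "c > 0"
      have "V \<le> (\<integral>\<omega>. 2 * (\<eta>\<^sup>2 + D\<^sup>2) *
          (ln c + (\<gamma> + (\<Delta> + (\<Sum>k=1..t. W k \<omega>)) / (2 * \<eta>)) / (\<gamma> * c) - 1) \<partial>M)"
        unfolding V_def
      proof (rule integral_mono_AE[OF d_int])
        show "integrable M (\<lambda>\<omega>. 2 * (\<eta>\<^sup>2 + D\<^sup>2) *
          (ln c + (\<gamma> + (\<Delta> + (\<Sum>k=1..t. W k \<omega>)) / (2 * \<eta>)) / (\<gamma> * c) - 1))"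
          using W_int by simp
        show "AE \<omega> in M. (\<Sum>k=1..t. (d k \<omega>)\<^sup>2) \<le> 2 * (\<eta>\<^sup>2 + D\<^sup>2) *
          (ln c + (\<gamma> + (\<Delta> + (\<Sum>k=1..t. W k \<omega>)) / (2 * \<eta>)) / (\<gamma> * c) - 1)"
          using path by eventually_elim (use c in blast)
      qed
      also have "\<dots> = 2 * (\<eta>\<^sup>2 + D\<^sup>2) * (ln c + (\<gamma> + (\<Delta> + Q) / (2 * \<eta>)) / (\<gamma> * c) - 1)"
        using W_int by (simp add: prob_space Q_def)
      finally show "V \<le> 2 * (\<eta>\<^sup>2 + D\<^sup>2) * (ln c + (\<gamma> + (\<Delta> + Q) / (2 * \<eta>)) / (\<gamma> * c) - 1)" .
    qed
    finally show ?thesis .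
  qed
  show ?thesis
    unfolding \<Delta>(1) using rate rate_const_pos[OF G pos(1-3) \<Delta>(2)] by blast
qed

end
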